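(* Let $n\ge 1$ be an integer. For all $f:\{0,1\}^n\to \{0,1\}$, $$\|\nabla f\|_1\ge \|f-\mathbf{E}f\|_1.$$ Equality is achieved when $f=\mathbf{1}_A$ for a half-cube $A$.
   Context: For $g:\{0,1\}^n\to\mathbb{R}$, $\mathbf{E} g = 2^{-n}\sum_{x\in\{0,1\}^n} g(x)$ and $\|g\|_1=\mathbf{E}|g|$. For $x\in\{0,1\}^n$, $x\oplus e_i$ is the point obtained from $x$ by flipping its $i$-th bit. The discrete gradient has length $|\nabla f(x)|=\sqrt{\sum_{i=1}^n \big(\tfrac12(f(x)-f(x\oplus e_i))\big)^2}$, and $\|\nabla f\|_1=\mathbf{E}|\nabla f|$. A half-cube is a set of the form $\{x\in\{0,1\}^n : x_i=\epsilon\}$ for some $i\in\{1,\dots,n\}$ and $\epsilon\in\{0,1\}$. *)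

theory Defs
  imports Complex_Main "HOL-Library.FuncSet" "HOL-Library.Indicator_Function"
begin

text \<open>
  Points of \<open>{0,1}\<^sup>n\<close> are extensional functions on \<open>{1..n}\<close> (value \<open>undefined\<close> outside), so that
  the cube has exactly \<open>2\<^sup>n\<close> elements. A function \<open>g : {0,1}\<^sup>n \<rightarrow> \<real>\<close> is a HOL function of type
  \<open>(nat \<Rightarrow> nat) \<Rightarrow> real\<close>; the notions below only use its values on \<open>cube n\<close>.
\<close>

definition cube :: "nat \<Rightarrow> (nat \<Rightarrow> nat) set" where
  "cube n = {1..n} \<rightarrow>\<^sub>E {0, 1}"

definition expect :: "nat \<Rightarrow> ((nat \<Rightarrow> nat) \<Rightarrow> real) \<Rightarrow> real" where
  "expect n g = (\<Sum>x\<in>cube n. g x) / 2 ^ n"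

definition norm1 :: "nat \<Rightarrow> ((nat \<Rightarrow> nat) \<Rightarrow> real) \<Rightarrow> real" where
  "norm1 n g = expect n (\<lambda>x. \<bar>g x\<bar>)"

text \<open>\<open>flip_bit x i\<close> is \<open>x \<oplus> e\<^sub>i\<close>: for bits, \<open>1 - b\<close> in \<open>nat\<close> exchanges \<open>0\<close> and \<open>1\<close>.\<close>

definition flip_bit :: "(nat \<Rightarrow> nat) \<Rightarrow> nat \<Rightarrow> (nat \<Rightarrow> nat)" where
  "flip_bit x i = x(i := 1 - x i)"

definition grad_length :: "nat \<Rightarrow> ((nat \<Rightarrow> nat) \<Rightarrow> real) \<Rightarrow> (nat \<Rightarrow> nat) \<Rightarrow> real" where
  "grad_length n f x = sqrt (\<Sum>i=1..n. (1/2 * (f x - f (flip_bit x i)))\<^sup>2)"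

definition grad_norm1 :: "nat \<Rightarrow> ((nat \<Rightarrow> nat) \<Rightarrow> real) \<Rightarrow> real" where
  "grad_norm1 n f = expect n (grad_length n f)"

definition half_cube :: "nat \<Rightarrow> (nat \<Rightarrow> nat) set \<Rightarrow> bool" where
  "half_cube n A \<longleftrightarrow> (\<exists>i\<in>{1..n}. \<exists>\<epsilon>\<in>{0, 1}. A = {x \<in> cube n. x i = \<epsilon>})"

end

theory Submission imports Defs
begin

text \<open>
  Let \<open>f\<close> be the indicator of \<open>A\<close>, let \<open>p\<close> be the density of \<open>A\<close>, and let \<open>h(x)\<close> be the number of
  neighbours of \<open>x\<close> on the side of the partition \<open>A\<close>, \<open>A\<^sup>c\<close> that does not contain \<open>x\<close>. Then
  \<open>|\<nabla>f(x)| = \<surd>h(x) / 2\<close>, while \<open>E|f - Ef| = 2p(1-p)\<close>. The gradient norm is therefore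
  \<open>(\<Phi>(A) + \<Phi>(A\<^sup>c)) / 2\<close>, where \<open>\<Phi>(A)\<close> is \<open>2\<^sup>-\<^sup>n\<close> times the sum of \<open>\<surd>h\<close> over \<open>A\<close> alone, and it
  is enough to find a function \<open>B\<close> with \<open>\<Phi>(A) \<ge> B(p)\<close> for all sets \<open>A\<close> and
  \<open>B(p) + B(1-p) \<ge> 4p(1-p)\<close>.

  The bound \<open>\<Phi>(A) \<ge> B(p)\<close> is proved by induction on \<open>n\<close>. The last coordinate cuts \<open>A\<close> into two
  sections \<open>X\<close> and \<open>Y\<close> of densities \<open>x \<le> y\<close> with mean \<open>p\<close>. Every point of \<open>Y - X\<close>, a set of
  density at least \<open>d = y - x\<close>, gains one exit. This raises \<open>\<Phi>(Y) = b\<close> at least to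
  \<open>\<surd>(b\<^sup>2 + d\<^sup>2)\<close>, by Minkowski's inequality, and at least to \<open>d + (\<surd>2 - 1) b\<close>, because \<open>h\<close> takes
  integer values. Call the larger number \<open>gain b d\<close>. Then \<open>B\<close> is a lower bound as soon as it vanishes
  at \<open>0\<close> and \<open>1\<close> and satisfies the two-point inequality
  \<open>2 B((x+y)/2) \<le> B(x) + gain (B(y)) (y - x)\<close> for \<open>x \<le> y\<close> (\<open>root_boundary_ge\<close>).

  The symmetric candidate \<open>2p(1-p)\<close> fails: a subcube of codimension two has \<open>p = 1/4\<close> and
  \<open>\<Phi> = \<surd>2/4 < 3/8\<close>. But its complement has \<open>\<Phi> = 1/2 > 3/8\<close>, so there is room for a profile that
  lies below \<open>2p(1-p)\<close> on the left half of the unit interval and above it on the right half. The only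
  values that are forced are \<open>B(0) = B(1) = 0\<close> and \<open>B(1/2) = 1/2\<close>, the last one by half-cubes. For
  \<open>y\<close> close to \<open>x\<close> the two-point inequality amounts to \<open>B B'' \<ge> -2\<close>. On the right half, solutions of
  \<open>B B'' = -2 \<kappa>\<close> with \<open>\<kappa>\<close> slightly less than one meet the constraints; their slope
  becomes infinite at \<open>1\<close>, very slowly, and a rational function with a pole beyond \<open>1\<close> imitates them.
  On the left half two quadratic pieces suffice. The resulting \<open>profile\<close> satisfies the
  two-point inequality with small margins, and its coefficients are simple numbers found numerically
  inside these margins.

  The two-point inequality is then verified according to the position of \<open>x\<close>, \<open>y\<close> and their midpoint.
  Quadratic pieces have explicit second differences, so that for fixed \<open>y\<close> both sides can be
  interpolated between the end points of a range of \<open>x\<close>; this reduces everything to polynomial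
  inequalities in one variable (\<open>two_point_left\<close>, \<open>straddle\<close>, \<open>two_point_far_right\<close>). On the rational
  piece the second difference is also explicit, and \<open>high_piece_curvature\<close> is the quantitative form of
  \<open>B B'' \<ge> -2\<close> that controls it (\<open>two_point_near_right\<close>).
\<close>

section \<open>Square roots of vertex boundaries and sections of the cube\<close>

text \<open>
  A lower bound for what a sum of square roots becomes, starting from \<open>b\<close>, when a set of mass \<open>d\<close>
  receives one more exit per point; see \<open>gain_le_sum\<close>.
\<close>

definition gain :: "real \<Rightarrow> real \<Rightarrow> real" where
  "gain b d = max (sqrt (b\<^sup>2 + d\<^sup>2)) (d + (sqrt 2 - 1) * b)"

definition exits :: "nat \<Rightarrow> (nat \<Rightarrow> nat) set \<Rightarrow> (nat \<Rightarrow> nat) \<Rightarrow> nat" where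
  "exits n A x = card {i \<in> {1..n}. flip_bit x i \<notin> A}"

definition root_boundary :: "nat \<Rightarrow> (nat \<Rightarrow> nat) set \<Rightarrow> real" where
  "root_boundary n A = (\<Sum>x\<in>A. sqrt (real (exits n A x)))"

definition section_at :: "nat \<Rightarrow> (nat \<Rightarrow> nat) set \<Rightarrow> nat \<Rightarrow> (nat \<Rightarrow> nat) set" where
  "section_at n A j = {x \<in> cube n. x(Suc n := j) \<in> A}"

lemma finite_cube [simp]: "finite (cube n)"
  unfolding cube_def by (intro finite_PiE) auto

lemma card_cube: "card (cube n) = 2 ^ n"
  unfolding cube_def by (subst card_PiE) (auto simp: card_insert_if numeral_2_eq_2)

lemma cube_restrict: "x \<in> cube (Suc n) \<Longrightarrow> x(Suc n := undefined) \<in> cube n"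
  unfolding cube_def by (auto simp: PiE_def extensional_def Pi_def)

lemma cube_values: "x \<in> cube n \<Longrightarrow> i \<in> {1..n} \<Longrightarrow> x i \<in> {0, 1}"
  unfolding cube_def by (auto simp: PiE_def Pi_def)

lemma cube_undefined: "x \<in> cube n \<Longrightarrow> x (Suc n) = undefined"
  unfolding cube_def by (auto simp: PiE_def extensional_def)

lemma flip_bit_in_cube: "x \<in> cube n \<Longrightarrow> i \<in> {1..n} \<Longrightarrow> flip_bit x i \<in> cube n"
  unfolding cube_def flip_bit_def by (auto simp: PiE_def extensional_def Pi_def)

lemma inj_on_extend: "inj_on (\<lambda>x. x(Suc n := j)) (cube n)"
proof (rule inj_onI)
  fix x y assume xy: "x \<in> cube n" "y \<in> cube n" "x(Suc n := j) = y(Suc n := j)"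
  show "x = y"
  proof
    fix i show "x i = y i"
      using fun_cong[OF xy(3), of i] cube_undefined[OF xy(1)] cube_undefined[OF xy(2)]
      by (cases "i = Suc n") auto
  qed
qed

text \<open>
  The map \<open>x(Suc n := j)\<close> identifies the section at \<open>j\<close> with the points of \<open>A\<close> whose last bit is \<open>j\<close>.
\<close>

lemma sum_sections:
  fixes g :: "(nat \<Rightarrow> nat) \<Rightarrow> real"
  assumes "A \<subseteq> cube (Suc n)"
  shows "(\<Sum>x\<in>A. g x) = (\<Sum>x\<in>section_at n A 0. g (x(Suc n := 0))) + (\<Sum>x\<in>section_at n A 1. g (x(Suc n := 1)))"
proof -
  let ?e = "\<lambda>j x. x(Suc n := j)"
  have A: "A = ?e 0 ` section_at n A 0 \<union> ?e 1 ` section_at n A 1"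
  proof (intro set_eqI iffI)
    fix x assume x: "x \<in> A"
    with assms have c: "x \<in> cube (Suc n)" by auto
    define y where "y = x(Suc n := undefined)"
    have y: "y \<in> cube n" using cube_restrict[OF c] by (simp add: y_def)
    have "x (Suc n) \<in> {0,1}" using cube_values[OF c] by auto
    moreover have "x = ?e (x (Suc n)) y" by (auto simp: y_def)
    ultimately show "x \<in> ?e 0 ` section_at n A 0 \<union> ?e 1 ` section_at n A 1"
      using x y by (auto simp: section_at_def image_iff intro!: bexI[of _ y])
  qed (auto simp: section_at_def)
  have disj: "?e 0 ` section_at n A 0 \<inter> ?e 1 ` section_at n A 1 = {}"
    by (auto dest!: fun_cong[of _ _ "Suc n"])
  have fin: "finite (section_at n A j)" for j
    by (rule finite_subset[OF _ finite_cube[of n]]) (auto simp: section_at_def)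
  have inj: "inj_on (?e j) (section_at n A j)" for j
    by (rule inj_on_subset[OF inj_on_extend]) (auto simp: section_at_def)
  have "(\<Sum>x\<in>A. g x) = (\<Sum>x\<in>?e 0 ` section_at n A 0. g x) + (\<Sum>x\<in>?e 1 ` section_at n A 1. g x)"
    by (subst A, rule sum.union_disjoint) (use fin disj in auto)
  then show ?thesis
    by (simp add: sum.reindex[OF inj] o_def)
qed

text \<open>
  Flips of the first \<open>n\<close> bits stay inside the section, and the flip of the last bit lands at the same
  point of the other section.
\<close>

lemma exits_extend:
  assumes "x \<in> section_at n A j" "j \<in> {0, 1}"
  shows "exits (Suc n) A (x(Suc n := j)) =
    exits n (section_at n A j) x + (if x \<in> section_at n A (1 - j) then 0 else 1)"
proof -
  have x: "x \<in> cube n" using assms by (auto simp: section_at_def)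
  let ?S = "{i \<in> {1..n}. flip_bit x i \<notin> section_at n A j}"
  have "flip_bit (x(Suc n := j)) i = (flip_bit x i)(Suc n := j)" if "i \<in> {1..n}" for i
    using that by (auto simp: flip_bit_def fun_upd_twist)
  then have low: "flip_bit (x(Suc n := j)) i \<notin> A \<longleftrightarrow> flip_bit x i \<notin> section_at n A j" if "i \<in> {1..n}" for i
    using that flip_bit_in_cube[OF x that] by (simp add: section_at_def)
  have top: "flip_bit (x(Suc n := j)) (Suc n) \<notin> A \<longleftrightarrow> x \<notin> section_at n A (1 - j)"
    using x by (simp add: flip_bit_def section_at_def)
  have "{i \<in> {1..Suc n}. flip_bit (x(Suc n := j)) i \<notin> A} =
      ?S \<union> (if x \<in> section_at n A (1 - j) then {} else {Suc n})"
    using low top by (auto simp: le_Suc_eq)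
  then show ?thesis
    unfolding exits_def by (auto simp: card_insert_if)
qed

text \<open>
  The left-hand side is the chord of the convex function \<open>\<surd>(t\<^sup>2 + 1)\<close> through \<open>t = 0\<close> and \<open>t = 1\<close>, at
  \<open>t = \<surd>h\<close>. The inequality fails for real \<open>h\<close> strictly between \<open>0\<close> and \<open>1\<close>: this is where integrality
  enters. The resulting part of the gain beats Minkowski's inequality when \<open>d > b\<close>.
\<close>

lemma sqrt_Suc_ge: "1 + (sqrt 2 - 1) * sqrt (real h) \<le> sqrt (real h + 1)"
proof (cases "h = 0")
  case False
  define s where "s = sqrt (real h)"
  have s: "1 \<le> s" "s\<^sup>2 = real h" using False by (auto simp: s_def)
  have r: "(sqrt 2)\<^sup>2 = 2" "1 \<le> sqrt 2" by auto
  define c where "c = sqrt 2 - 1"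
  have c: "c\<^sup>2 + 2*c = 1" "0 \<le> c" using r by (auto simp: c_def power2_eq_square algebra_simps)
  have "s\<^sup>2 + 1 - (1 + c * s)\<^sup>2 = 2 * c * s * (s - 1)"
    using c(1) by algebra
  moreover have "0 \<le> 2 * c * s * (s - 1)" using c s by simp
  ultimately have "(1 + c * s)\<^sup>2 \<le> s\<^sup>2 + 1" by linarith
  then show ?thesis using s c by (auto simp: s_def c_def intro!: real_le_rsqrt)
qed simp

lemma gain_le_sum:
  assumes fin: "finite Y" and D: "D \<subseteq> Y"
  shows "gain (\<Sum>x\<in>Y. sqrt (real (h x))) (real (card D))
    \<le> (\<Sum>x\<in>Y. sqrt (real (h x + (if x \<in> D then 1 else 0))))"
proof -
  let ?i = "\<lambda>x. if x \<in> D then 1 else (0::nat)"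
  have cd: "(\<Sum>x\<in>Y. real (?i x)) = real (card D)"
    using fin D by (simp add: sum.If_cases Int_absorb1 flip: of_nat_sum)
  \<comment> \<open>Minkowski's inequality is the triangle inequality for the vectors \<open>(\<surd>h(x), 1\<^sub>D(x))\<close> of the plane,
    written as complex numbers.\<close>
  have "cmod (\<Sum>x\<in>Y. Complex (sqrt (real (h x))) (real (?i x)))
      \<le> (\<Sum>x\<in>Y. cmod (Complex (sqrt (real (h x))) (real (?i x))))"
    by (rule norm_sum)
  also have "(\<Sum>x\<in>Y. Complex (sqrt (real (h x))) (real (?i x)))
      = Complex (\<Sum>x\<in>Y. sqrt (real (h x))) (real (card D))"
    unfolding cd[symmetric] by (simp add: complex_eq_iff)
  also have "(\<Sum>x\<in>Y. cmod (Complex (sqrt (real (h x))) (real (?i x))))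
      = (\<Sum>x\<in>Y. sqrt (real (h x + ?i x)))"
    by (intro sum.cong) (auto simp: cmod_def)
  finally have 1: "sqrt ((\<Sum>x\<in>Y. sqrt (real (h x)))\<^sup>2 + (real (card D))\<^sup>2)
      \<le> (\<Sum>x\<in>Y. sqrt (real (h x + ?i x)))"
    by (simp add: cmod_def)
  have "real (card D) + (sqrt 2 - 1) * (\<Sum>x\<in>Y. sqrt (real (h x)))
      = (\<Sum>x\<in>Y. real (?i x) + (sqrt 2 - 1) * sqrt (real (h x)))"
    by (simp only: sum.distrib sum_distrib_left cd)
  also have "\<dots> \<le> (\<Sum>x\<in>Y. sqrt (real (h x + ?i x)))"
  proof (rule sum_mono)
    fix x
    have "(sqrt 2 - 1) * sqrt (real (h x)) \<le> 1 * sqrt (real (h x))"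
      by (intro mult_right_mono) (auto intro: real_le_lsqrt)
    then show "real (?i x) + (sqrt 2 - 1) * sqrt (real (h x)) \<le> sqrt (real (h x + ?i x))"
      using sqrt_Suc_ge[of "h x"] by (auto simp: add.commute)
  qed
  finally show ?thesis using 1 by (simp add: gain_def)
qed

lemma gain_mono:
  assumes "0 \<le> b" "b \<le> b'" "0 \<le> d" "d \<le> d'"
  shows "gain b d \<le> gain b' d'"
proof -
  have "b\<^sup>2 + d\<^sup>2 \<le> b'\<^sup>2 + d'\<^sup>2" using assms by (intro add_mono power_mono) auto
  moreover have "(sqrt 2 - 1) * b \<le> (sqrt 2 - 1) * b'" using assms by (intro mult_left_mono) auto
  ultimately show ?thesis
    unfolding gain_def using assms by (intro max.mono real_sqrt_le_mono) (assumption, linarith)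
qed

lemma gain_scale: "0 \<le> t \<Longrightarrow> gain (t * b) (t * d) = t * gain b d"
proof -
  assume t: "0 \<le> t"
  have "(t*b)\<^sup>2 + (t*d)\<^sup>2 = t\<^sup>2 * (b\<^sup>2 + d\<^sup>2)" by (simp add: power_mult_distrib algebra_simps)
  then have "sqrt ((t*b)\<^sup>2 + (t*d)\<^sup>2) = t * sqrt (b\<^sup>2 + d\<^sup>2)" using t by (simp add: real_sqrt_mult)
  moreover have "t*d + (sqrt 2 - 1) * (t*b) = t * (d + (sqrt 2 - 1) * b)" by (simp add: algebra_simps)
  ultimately show ?thesis using t by (simp add: gain_def max_mult_distrib_left)
qed

text \<open>
  Only the larger section \<open>Y\<close> is credited with new exits; those of \<open>X - Y\<close> are discarded. Nothing is lost
  in the critical case of nested sections.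
\<close>

lemma root_boundary_sections:
  assumes A: "A \<subseteq> cube (Suc n)" and j: "j \<in> {0, 1}"
    and le: "card (section_at n A j) \<le> card (section_at n A (1 - j))"
  defines "X \<equiv> section_at n A j" and "Y \<equiv> section_at n A (1 - j)"
  shows "root_boundary n X + gain (root_boundary n Y) (real (card Y) - real (card X)) \<le> root_boundary (Suc n) A"
proof -
  have fin: "finite X" "finite Y"
    unfolding X_def Y_def by (rule finite_subset[OF _ finite_cube[of n]], auto simp: section_at_def)+
  have split: "root_boundary (Suc n) A
      = (\<Sum>x\<in>X. sqrt (real (exits (Suc n) A (x(Suc n := j)))))
      + (\<Sum>x\<in>Y. sqrt (real (exits (Suc n) A (x(Suc n := 1 - j)))))"
    unfolding root_boundary_def sum_sections[OF A] X_def Y_def using j by auto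
  have 1: "root_boundary n X \<le> (\<Sum>x\<in>X. sqrt (real (exits (Suc n) A (x(Suc n := j)))))"
    unfolding root_boundary_def
    by (rule sum_mono) (use j in \<open>auto simp: X_def exits_extend simp del: fun_upd_apply\<close>)
  have jj: "1 - (1 - j) = j" using j by auto
  have "(\<Sum>x\<in>Y. sqrt (real (exits (Suc n) A (x(Suc n := 1 - j)))))
      = (\<Sum>x\<in>Y. sqrt (real (exits n Y x + (if x \<in> Y - X then 1 else 0))))"
    by (rule sum.cong[OF refl])
       (use j in \<open>auto simp: X_def Y_def exits_extend jj simp del: fun_upd_apply\<close>)
  moreover have "gain (root_boundary n Y) (real (card (Y - X)))
      \<le> (\<Sum>x\<in>Y. sqrt (real (exits n Y x + (if x \<in> Y - X then 1 else 0))))"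
    unfolding root_boundary_def by (rule gain_le_sum[OF fin(2)]) auto
  moreover have "gain (root_boundary n Y) (real (card Y) - real (card X)) \<le> gain (root_boundary n Y) (real (card (Y - X)))"
  proof (rule gain_mono)
    have "card Y \<le> card X + card (Y - X)"
      using fin by (metis Diff_partition Un_Diff_cancel card_Un_le card_mono finite_Diff finite_UnI le_trans sup_ge2)
    then show "real (card Y) - real (card X) \<le> real (card (Y - X))" by linarith
  qed (use le in \<open>auto simp: X_def Y_def root_boundary_def intro!: sum_nonneg\<close>)
  ultimately show ?thesis using 1 split by linarith
qed

text \<open>
  Induction on the dimension. Since \<open>gain\<close> is homogeneous and monotone, the induction hypothesis for the
  two sections can be inserted into \<open>root_boundary_sections\<close>, and the two-point inequality is exactly
  what remains.
\<close>

theorem root_boundary_ge: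
  fixes B :: "real \<Rightarrow> real"
  assumes B0: "B 0 = 0" and B1: "B 1 = 0" and nn: "\<And>x. 0 \<le> x \<Longrightarrow> x \<le> 1 \<Longrightarrow> 0 \<le> B x"
    and two_point: "\<And>x y. 0 \<le> x \<Longrightarrow> x \<le> y \<Longrightarrow> y \<le> 1 \<Longrightarrow> 2 * B ((x + y) / 2) \<le> B x + gain (B y) (y - x)"
  assumes "A \<subseteq> cube n"
  shows "2 ^ n * B (real (card A) / 2 ^ n) \<le> root_boundary n A"
  using assms(5)
proof (induction n arbitrary: A)
  case 0
  have "cube 0 = {\<lambda>_. undefined}" by (auto simp: cube_def)
  then have "A = {} \<or> A = cube 0" using 0 by auto
  then show ?case using B0 B1 card_cube[of 0] by (auto simp: root_boundary_def exits_def)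
next
  case (Suc n)
  obtain j :: nat where j: "j \<in> {0,1}" "card (section_at n A j) \<le> card (section_at n A (1 - j))"
  proof (cases "card (section_at n A 0) \<le> card (section_at n A 1)")
    case True then show ?thesis using that[of 0] by simp
  next
    case False then show ?thesis using that[of 1] by simp
  qed
  let ?X = "section_at n A j" and ?Y = "section_at n A (1 - j)"
  have sub: "?X \<subseteq> cube n" "?Y \<subseteq> cube n" by (auto simp: section_at_def)
  define x where "x = real (card ?X) / 2 ^ n"
  define y where "y = real (card ?Y) / 2 ^ n"
  have xy: "0 \<le> x" "x \<le> y" "y \<le> 1"
    using j(2) card_mono[OF finite_cube sub(2)] by (auto simp: x_def y_def card_cube divide_right_mono)
  have "real (card A) = real (card ?X) + real (card ?Y)"
    using sum_sections[OF Suc.prems, of "\<lambda>_. 1"] j(1) by auto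
  then have mid: "real (card A) / 2 ^ Suc n = (x + y) / 2"
    by (simp add: x_def y_def field_simps)
  have diff: "real (card ?Y) - real (card ?X) = 2 ^ n * (y - x)"
    by (simp add: x_def y_def field_simps)
  have "2 ^ Suc n * B (real (card A) / 2 ^ Suc n) \<le> 2 ^ n * (B x + gain (B y) (y - x))"
    unfolding mid using two_point[OF xy] by simp
  also have "\<dots> = 2 ^ n * B x + gain (2 ^ n * B y) (2 ^ n * (y - x))"
    by (simp only: gain_scale[of "2 ^ n"] distrib_left zero_le_power zero_le_numeral)
  also have "\<dots> \<le> root_boundary n ?X + gain (root_boundary n ?Y) (2 ^ n * (y - x))"
    using Suc.IH[OF sub(1)] Suc.IH[OF sub(2)] nn[of y] xy
    by (intro add_mono gain_mono) (auto simp: x_def y_def)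
  also have "\<dots> \<le> root_boundary (Suc n) A"
    using root_boundary_sections[OF Suc.prems j] unfolding diff .
  finally show ?case .
qed

section \<open>The gradient of a Boolean function\<close>

text \<open>
  Each neighbour across the boundary contributes \<open>1/4\<close> to the square of the gradient, whichever side
  \<open>x\<close> lies on.
\<close>

lemma grad_length_indicator:
  assumes f: "f \<in> cube n \<rightarrow> {0, 1}" and x: "x \<in> cube n"
  defines "A \<equiv> {x \<in> cube n. f x = 1}"
  shows "grad_length n f x = sqrt (real (exits n (if x \<in> A then A else cube n - A) x)) / 2"
proof -
  let ?C = "if x \<in> A then A else cube n - A"
  have sq: "(1/2 * (f x - f (flip_bit x i)))\<^sup>2 = (if flip_bit x i \<notin> ?C then 1/4 else 0)" if i: "i \<in> {1..n}" for i
  proof -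
    have "f x = 0 \<or> f x = 1" "f (flip_bit x i) = 0 \<or> f (flip_bit x i) = 1" "flip_bit x i \<in> cube n"
      using f x flip_bit_in_cube[OF x i] by auto
    then show ?thesis using x by (auto simp: A_def power2_eq_square)
  qed
  have "(\<Sum>i=1..n. (1/2 * (f x - f (flip_bit x i)))\<^sup>2) = (\<Sum>i=1..n. if flip_bit x i \<notin> ?C then 1/4 else 0)"
    by (rule sum.cong[OF refl sq])
  also have "\<dots> = real (exits n ?C x) / 4"
    unfolding exits_def by (subst sum.inter_filter[symmetric]) auto
  finally have S: "(\<Sum>i=1..n. (1/2 * (f x - f (flip_bit x i)))\<^sup>2) = real (exits n ?C x) / 4" .
  show ?thesis unfolding grad_length_def S by (simp add: real_sqrt_divide)
qed

lemma grad_norm1_indicator: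
  assumes f: "f \<in> cube n \<rightarrow> {0, 1}"
  defines "A \<equiv> {x \<in> cube n. f x = 1}"
  shows "grad_norm1 n f = (root_boundary n A + root_boundary n (cube n - A)) / (2 * 2 ^ n)"
proof -
  have sub: "A \<subseteq> cube n" by (auto simp: A_def)
  have "(\<Sum>x\<in>cube n. grad_length n f x)
      = (\<Sum>x\<in>cube n. sqrt (real (exits n (if x \<in> A then A else cube n - A) x)) / 2)"
    unfolding A_def by (rule sum.cong[OF refl grad_length_indicator[OF f]])
  also have "\<dots> = (\<Sum>x\<in>cube n - A. sqrt (real (exits n (if x \<in> A then A else cube n - A) x)) / 2)
      + (\<Sum>x\<in>A. sqrt (real (exits n (if x \<in> A then A else cube n - A) x)) / 2)"
    by (rule sum.subset_diff[OF sub finite_cube])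
  also have "\<dots> = (root_boundary n A + root_boundary n (cube n - A)) / 2"
    by (simp add: root_boundary_def sum_divide_distrib add_divide_distrib)
  finally have S: "(\<Sum>x\<in>cube n. grad_length n f x) = (root_boundary n A + root_boundary n (cube n - A)) / 2" .
  show ?thesis unfolding grad_norm1_def expect_def S by simp
qed

lemma norm1_indicator:
  assumes f: "f \<in> cube n \<rightarrow> {0, 1}"
  defines "p \<equiv> real (card {x \<in> cube n. f x = 1}) / 2 ^ n"
  shows "norm1 n (\<lambda>x. f x - expect n f) = 2 * p * (1 - p)"
proof -
  let ?A = "{x \<in> cube n. f x = 1}"
  have f01: "f x = (if x \<in> ?A then 1 else 0)" if "x \<in> cube n" for x using f that by auto
  have "(\<Sum>x\<in>cube n. f x) = (\<Sum>x\<in>cube n. if x \<in> ?A then 1 else 0)"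
    by (rule sum.cong[OF refl f01])
  also have "\<dots> = real (card ?A)" by (simp add: sum.If_cases Int_def)
  finally have E: "expect n f = p" by (simp add: expect_def p_def)
  have p: "0 \<le> p" "p \<le> 1"
    using card_mono[of "cube n" ?A] by (auto simp: p_def card_cube)
  have c: "real (card (cube n - ?A)) = 2 ^ n - real (card ?A)"
    using card_mono[of "cube n" ?A] by (subst card_Diff_subset) (auto simp: card_cube of_nat_diff)
  have "(\<Sum>x\<in>cube n. \<bar>f x - p\<bar>) = (\<Sum>x\<in>cube n. if x \<in> ?A then 1 - p else p)"
    using p by (intro sum.cong[OF refl]) (subst f01, auto)
  also have "\<dots> = (\<Sum>x\<in>cube n - ?A. if x \<in> ?A then 1 - p else p) + (\<Sum>x\<in>?A. if x \<in> ?A then 1 - p else p)"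
    by (rule sum.subset_diff) auto
  also have "\<dots> = real (card (cube n - ?A)) * p + real (card ?A) * (1 - p)" by simp
  also have "\<dots> = 2 ^ n * (2 * p * (1 - p))"
    unfolding c by (simp add: p_def field_simps)
  finally have S: "(\<Sum>x\<in>cube n. \<bar>f x - p\<bar>) = 2 ^ n * (2 * p * (1 - p))" .
  show ?thesis unfolding norm1_def E unfolding expect_def S by simp
qed

lemma root_boundary_half_cube:
  assumes i: "i \<in> {1..n}" and e: "\<epsilon> \<in> {0, 1}"
  shows "root_boundary n {x \<in> cube n. x i = \<epsilon>} = real (card {x \<in> cube n. x i = \<epsilon>})"
proof -
  have "exits n {x \<in> cube n. x i = \<epsilon>} x = 1" if "x \<in> {x \<in> cube n. x i = \<epsilon>}" for x
  proof -
    have "flip_bit x k \<notin> {x \<in> cube n. x i = \<epsilon>} \<longleftrightarrow> k = i" if k: "k \<in> {1..n}" for k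
      using \<open>x \<in> _\<close> flip_bit_in_cube[OF _ k, of x] e by (auto simp: flip_bit_def)
    then have "{k \<in> {1..n}. flip_bit x k \<notin> {x \<in> cube n. x i = \<epsilon>}} = {i}"
      using i by blast
    then show ?thesis by (simp add: exits_def)
  qed
  then show ?thesis by (simp add: root_boundary_def)
qed

text \<open>
  Flipping the \<open>i\<close>-th bit exchanges the two half-cubes of direction \<open>i\<close>.
\<close>

lemma card_half_cube:
  assumes i: "i \<in> {1..n}" and e: "\<epsilon> \<in> {0, 1}"
  shows "2 * card {x \<in> cube n. x i = \<epsilon>} = 2 ^ n"
proof -
  let ?H = "\<lambda>\<epsilon>. {x \<in> cube n. x i = \<epsilon>}"
  have e1: "1 - \<epsilon> \<in> {0, 1}" "1 - (1 - \<epsilon>) = \<epsilon>" "1 - \<epsilon> \<noteq> \<epsilon>" using e by auto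
  have inv: "flip_bit (flip_bit x i) i = x" if "x \<in> cube n" for x
    using cube_values[OF that i] by (auto simp: flip_bit_def)
  have maps: "flip_bit x i \<in> ?H (1 - \<delta>)" if "x \<in> ?H \<delta>" for x \<delta>
    using that flip_bit_in_cube[OF _ i, of x] by (auto simp: flip_bit_def)
  have "bij_betw (\<lambda>x. flip_bit x i) (?H \<epsilon>) (?H (1 - \<epsilon>))"
    using inv maps[of _ \<epsilon>] maps[of _ "1 - \<epsilon>"] unfolding e1(2)
    by (intro bij_betw_byWitness[where f' = "\<lambda>x. flip_bit x i"]) blast+
  then have "card (?H \<epsilon>) = card (?H (1 - \<epsilon>))" by (rule bij_betw_same_card)
  moreover have "card (?H \<epsilon> \<union> ?H (1 - \<epsilon>)) = card (?H \<epsilon>) + card (?H (1 - \<epsilon>))"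
    using e1(3) by (intro card_Un_disjoint) auto
  moreover have "?H \<epsilon> \<union> ?H (1 - \<epsilon>) = cube n"
    using cube_values[OF _ i] e by fastforce
  ultimately show ?thesis by (simp add: card_cube)
qed

lemma half_cube_equality:
  assumes "half_cube n A"
  shows "grad_norm1 n (indicator A) = norm1 n (\<lambda>x. indicator A x - expect n (indicator A))"
proof -
  obtain i \<epsilon> where i: "i \<in> {1..n}" and e: "\<epsilon> \<in> {0, 1}" and A: "A = {x \<in> cube n. x i = \<epsilon>}"
    using assms unfolding half_cube_def by blast
  let ?f = "indicator A :: (nat \<Rightarrow> nat) \<Rightarrow> real"
  have f: "?f \<in> cube n \<rightarrow> {0, 1}" by (auto simp: indicator_def)
  have supp: "{x \<in> cube n. ?f x = 1} = A" by (auto simp: A indicator_def)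
  have "cube n - A = {x \<in> cube n. x i = 1 - \<epsilon>}"
    using cube_values[OF _ i] e unfolding A by fastforce
  moreover have "real (card {x \<in> cube n. x i = \<epsilon>'}) = 2 ^ n / 2" if "\<epsilon>' \<in> {0, 1}" for \<epsilon>'
    using arg_cong[OF card_half_cube[OF i that], of real] by simp
  moreover have "1 - \<epsilon> \<in> {0, 1}" by auto
  ultimately have rb: "root_boundary n A = 2 ^ n / 2" "root_boundary n (cube n - A) = 2 ^ n / 2" "real (card A) = 2 ^ n / 2"
    using root_boundary_half_cube[OF i] e A by auto
  show ?thesis
    unfolding grad_norm1_indicator[OF f] norm1_indicator[OF f] supp rb by simp
qed

text \<open>
  The reduction of the Poincare inequality to the existence of a profile: apply \<open>root_boundary_ge\<close> to
  the set and to its complement.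
\<close>

lemma poincare_of_profile:
  fixes B :: "real \<Rightarrow> real"
  assumes B0: "B 0 = 0" and B1: "B 1 = 0" and nn: "\<And>x. 0 \<le> x \<Longrightarrow> x \<le> 1 \<Longrightarrow> 0 \<le> B x"
    and two_point: "\<And>x y. 0 \<le> x \<Longrightarrow> x \<le> y \<Longrightarrow> y \<le> 1 \<Longrightarrow> 2 * B ((x + y) / 2) \<le> B x + gain (B y) (y - x)"
    and sum: "\<And>p. 0 \<le> p \<Longrightarrow> p \<le> 1 \<Longrightarrow> 4 * p * (1 - p) \<le> B p + B (1 - p)"
    and f: "f \<in> cube n \<rightarrow> {0, 1}"
  shows "norm1 n (\<lambda>x. f x - expect n f) \<le> grad_norm1 n f"
proof -
  define A where "A = {x \<in> cube n. f x = 1}"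
  define p where "p = real (card A) / 2 ^ n"
  have sub: "A \<subseteq> cube n" by (auto simp: A_def)
  have cA: "card A \<le> 2 ^ n" using card_mono[OF finite_cube sub] by (simp add: card_cube)
  then have p: "0 \<le> p" "p \<le> 1" by (auto simp: p_def)
  have "real (card (cube n - A)) = 2 ^ n - real (card A)"
    using cA sub by (subst card_Diff_subset) (auto simp: card_cube of_nat_diff finite_subset[OF sub])
  then have c: "real (card (cube n - A)) / 2 ^ n = 1 - p" by (simp add: p_def field_simps)
  have ge: "2 ^ n * B (real (card C) / 2 ^ n) \<le> root_boundary n C" if "C \<subseteq> cube n" for C
    by (rule root_boundary_ge[OF B0 B1 nn two_point that])
  have "2 ^ n * B p \<le> root_boundary n A" using ge[OF sub] by (simp add: p_def)
  moreover have "2 ^ n * B (1 - p) \<le> root_boundary n (cube n - A)"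
    using ge[of "cube n - A"] by (simp add: c)
  moreover have "2 ^ n * (4 * p * (1 - p)) \<le> 2 ^ n * (B p + B (1 - p))"
    using sum[OF p] by simp
  ultimately have "2 ^ n * (4 * p * (1 - p)) \<le> root_boundary n A + root_boundary n (cube n - A)"
    by (simp only: distrib_left)
  then show ?thesis
    unfolding grad_norm1_indicator[OF f] norm1_indicator[OF f] A_def[symmetric] p_def[symmetric]
    by (simp add: field_simps)
qed

section \<open>Lower bounds for the gain, and polynomial inequalities on intervals\<close>

lemma gain_ge_circle: "S\<^sup>2 \<le> b\<^sup>2 + d\<^sup>2 \<Longrightarrow> S \<le> gain b d"
  by (auto simp: gain_def le_max_iff_disj intro: real_le_rsqrt)

text \<open>
  The norm \<open>\<surd>(b\<^sup>2 + d\<^sup>2)\<close> is the supremum of the linear forms \<open>\<alpha> b + \<beta> d\<close> with \<open>\<alpha>\<^sup>2 + \<beta>\<^sup>2 = 1\<close>, whose level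
  sets are tangents of the circle. A form adapted to the ratio \<open>d / b\<close> loses little, and it turns
  quadratic estimates into linear ones.
\<close>

lemma tangent_le_circle:
  fixes b d \<alpha> \<beta> :: real
  assumes "\<alpha>\<^sup>2 + \<beta>\<^sup>2 \<le> 1"
  shows "(\<alpha> * b + \<beta> * d)\<^sup>2 \<le> b\<^sup>2 + d\<^sup>2"
proof -
  have "(b\<^sup>2 + d\<^sup>2) - (\<alpha> * b + \<beta> * d)\<^sup>2 = (1 - \<alpha>\<^sup>2 - \<beta>\<^sup>2) * (b\<^sup>2 + d\<^sup>2) + (\<alpha> * d - \<beta> * b)\<^sup>2"
    by (simp add: power2_eq_square algebra_simps)
  moreover have "0 \<le> (1 - \<alpha>\<^sup>2 - \<beta>\<^sup>2) * (b\<^sup>2 + d\<^sup>2)" using assms by simp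
  ultimately show ?thesis by (smt (verit) zero_le_power2)
qed

lemma gain_ge_tangent:
  assumes "\<alpha>\<^sup>2 + \<beta>\<^sup>2 \<le> 1" "S \<le> \<alpha> * b + \<beta> * d"
  shows "S \<le> gain b d"
  using gain_ge_circle[OF tangent_le_circle[OF assms(1)]] assms(2) by (rule order_trans[rotated])

lemma circle_of_tangent:
  fixes S b d \<alpha> \<beta> :: real
  assumes "\<alpha>\<^sup>2 + \<beta>\<^sup>2 \<le> 1" "0 \<le> S" "S \<le> \<alpha> * b + \<beta> * d"
  shows "S\<^sup>2 \<le> b\<^sup>2 + d\<^sup>2"
  using power_mono[OF assms(3,2), of 2] tangent_le_circle[OF assms(1), of b d] by linarith

text \<open>
  The rational number \<open>207/500\<close> lies just below \<open>\<surd>2 - 1\<close>.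
\<close>

lemma gain_ge_linear:
  assumes "0 \<le> b" "S \<le> d + 207/500 * b"
  shows "S \<le> gain b d"
proof -
  have "707/500 \<le> sqrt 2" by (rule real_le_rsqrt) (simp add: power2_eq_square)
  then have "207/500 * b \<le> (sqrt 2 - 1) * b" using assms(1) by (intro mult_right_mono) auto
  then show ?thesis using assms(2) by (auto simp: gain_def)
qed

text \<open>
  The Bernstein criterion: a cubic is nonnegative on \<open>[a, b]\<close> if its four Bernstein coefficients are. They
  are its values at the end points and, up to a factor, the values at one third of the way of the
  tangents at the end points. Almost all polynomial inequalities in one variable below are decided by
  this test.
\<close>

lemma cubic_nonneg:
  fixes a b x :: real
  assumes "a \<le> x" "x \<le> b"
    and "0 \<le> c0 + c1*a + c2*a^2 + c3*a^3"
    and "0 \<le> 3*(c0 + c1*a + c2*a^2 + c3*a^3) + (b - a)*(c1 + 2*c2*a + 3*c3*a^2)"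
    and "0 \<le> 3*(c0 + c1*b + c2*b^2 + c3*b^3) - (b - a)*(c1 + 2*c2*b + 3*c3*b^2)"
    and "0 \<le> c0 + c1*b + c2*b^2 + c3*b^3"
  shows "0 \<le> c0 + c1*x + c2*x^2 + c3*x^3"
proof (cases "a = b")
  case True
  then have "x = a" using assms(1,2) by simp
  then show ?thesis using assms(3) by simp
next
  case False
  then have ab: "a < b" using assms(1,2) by simp
  have "(b - a)^3 * (c0 + c1*x + c2*x^2 + c3*x^3) =
      (c0 + c1*a + c2*a^2 + c3*a^3) * (b - x)^3
    + (3*(c0 + c1*a + c2*a^2 + c3*a^3) + (b - a)*(c1 + 2*c2*a + 3*c3*a^2)) * ((b - x)^2 * (x - a))
    + (3*(c0 + c1*b + c2*b^2 + c3*b^3) - (b - a)*(c1 + 2*c2*b + 3*c3*b^2)) * ((b - x) * (x - a)^2)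
    + (c0 + c1*b + c2*b^2 + c3*b^3) * (x - a)^3"
    by algebra
  also have "0 \<le> \<dots>"
    using assms by (intro add_nonneg_nonneg mult_nonneg_nonneg[OF assms(3)] mult_nonneg_nonneg[OF assms(4)]
        mult_nonneg_nonneg[OF assms(5)] mult_nonneg_nonneg[OF assms(6)] mult_nonneg_nonneg zero_le_power) auto
  finally show ?thesis using ab by (simp add: zero_le_mult_iff)
qed

text \<open>
  In the variable \<open>D = d\<^sup>2\<close> the inequality \<open>(q + k D)\<^sup>2 \<le> B + D\<close> says that a convex function is
  nonpositive, so it may be checked at the end points of a range of \<open>D\<close>.
\<close>

lemma circle_interpolate:
  fixes q k B D D0 D1 :: real
  assumes "(q + k * D0)\<^sup>2 \<le> B + D0" "(q + k * D1)\<^sup>2 \<le> B + D1" "D0 \<le> D" "D \<le> D1"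
  shows "(q + k * D)\<^sup>2 \<le> B + D"
proof (cases "D0 = D1")
  case True then show ?thesis using assms by auto
next
  case False
  then have lt: "D0 < D1" using assms by auto
  have "(D1 - D0) * (B + D - (q + k * D)\<^sup>2) = (D1 - D) * (B + D0 - (q + k * D0)\<^sup>2)
      + (D - D0) * (B + D1 - (q + k * D1)\<^sup>2) + k\<^sup>2 * ((D - D0) * (D1 - D) * (D1 - D0))"
    by algebra
  also have "0 \<le> \<dots>" using assms by (intro add_nonneg_nonneg mult_nonneg_nonneg) auto
  finally show ?thesis using lt by (simp add: zero_le_mult_iff)
qed

text \<open>
  If \<open>F\<close> and \<open>H\<close> are quadratic and \<open>H\<close> is sufficiently concave compared with \<open>F\<close>, then
  \<open>2 F((x+y)/2) - H(x)\<close> is convex in \<open>x\<close>. A linear upper bound for it may be checked at the end points of a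
  range of \<open>x\<close>.
\<close>

lemma quadratic_interpolate:
  fixes F H :: "real \<Rightarrow> real"
  assumes F: "\<And>t. F t = a + b*t + c*t^2" and H: "\<And>t. H t = a' + b'*t + c'*t^2"
    and curv: "c' \<le> c / 2"
    and ends: "2 * F ((x0 + y) / 2) - H x0 \<le> e + s * (y - x0)" "2 * F ((x1 + y) / 2) - H x1 \<le> e + s * (y - x1)"
    and x: "x0 \<le> x" "x \<le> x1"
  shows "2 * F ((x + y) / 2) - H x \<le> e + s * (y - x)"
proof (cases "x0 = x1")
  case True then show ?thesis using ends x by auto
next
  case False
  then have lt: "x0 < x1" using x by auto
  let ?g = "\<lambda>t. e + s * (y - t) - (2 * F ((t + y) / 2) - H t)"
  have "(x1 - x0) * ?g x = (x1 - x) * ?g x0 + (x - x0) * ?g x1 + (c/2 - c') * ((x - x0) * (x1 - x) * (x1 - x0))"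
    unfolding F H by (simp add: field_simps power2_eq_square)
  also have "0 \<le> \<dots>" using x curv ends by (intro add_nonneg_nonneg mult_nonneg_nonneg) auto
  finally show ?thesis using lt by (simp add: zero_le_mult_iff)
qed

section \<open>The isoperimetric profile\<close>

text \<open>
  The three pieces of the profile. The quadratics \<open>low_piece\<close> and \<open>mid_piece\<close> cross at \<open>1/4\<close>, where both
  take the value \<open>7/20\<close>; a subcube of codimension two limits the value there to \<open>\<surd>2/4 = 0.3535...\<close>. On
  the right half the profile is a function of \<open>v = 1 - x\<close>. Its pole at \<open>v = -1/6\<close> makes the slope steep near
  \<open>x = 1\<close>.
\<close>

definition low_piece :: "real \<Rightarrow> real" where "low_piece x = 2*x - 12/5 * x^2"
definition mid_piece :: "real \<Rightarrow> real" where "mid_piece x = -1/40 + 39/20*x - 9/5 * x^2"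
definition high_piece :: "real \<Rightarrow> real" where "high_piece v = v * (57/40 - 17/10*v + 17 / (10 * (6*v + 1)))"

definition profile :: "real \<Rightarrow> real" where
  "profile x = (if x \<le> 1/4 then low_piece x else if x \<le> 1/2 then mid_piece x else high_piece (1 - x))"

text \<open>
  Polynomial bounds for the rational piece in terms of \<open>z = x - 1/2\<close>. They share its value and its slope
  \<open>27/160\<close> at \<open>z = 0\<close>, so that only a small multiple of \<open>z\<^sup>2\<close> is lost.
\<close>

definition high_minorant :: "real \<Rightarrow> real" where
  "high_minorant z = 1/2 + 27/160*z - 93/50*z^2 - 19/50*z^3"
definition high_majorant :: "real \<Rightarrow> real" where
  "high_majorant z = 1/2 + 27/160*z - 371/200*z^2"

lemmas piece_defs = low_piece_def mid_piece_def high_minorant_def high_majorant_def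

lemma high_piece_eq: "0 \<le> v \<Longrightarrow> high_piece v = v * (125 + 274*v - 408*v^2) / (40 * (6*v + 1))"
  by (simp add: high_piece_def field_simps power2_eq_square)

lemma le_high_piece: "0 \<le> v \<Longrightarrow> t * (40 * (6*v + 1)) \<le> v * (125 + 274*v - 408*v^2) \<Longrightarrow> t \<le> high_piece v"
  by (subst high_piece_eq) (simp_all add: pos_le_divide_eq)

lemma high_piece_le: "0 \<le> v \<Longrightarrow> v * (125 + 274*v - 408*v^2) \<le> t * (40 * (6*v + 1)) \<Longrightarrow> high_piece v \<le> t"
  by (subst high_piece_eq) (simp_all add: pos_divide_le_eq)

lemma high_minorant_le:
  assumes "0 \<le> z" "z \<le> 1/4"
  shows "high_minorant z \<le> high_piece (1/2 - z)"
proof (rule le_high_piece)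
  have "0 \<le> z^2 * (1/10 + 112/5*z + (-456/5)*z^2 + 0*z^3)"
    by (rule mult_nonneg_nonneg[OF _ cubic_nonneg[where a=0 and b="1/4"]]) (use assms in \<open>auto simp: power_divide\<close>)
  then show "high_minorant z * (40 * (6 * (1/2 - z) + 1)) \<le> (1/2 - z) * (125 + 274 * (1/2 - z) - 408 * (1/2 - z)\<^sup>2)"
    unfolding high_minorant_def by (simp add: field_simps power2_eq_square power3_eq_cube)
qed (use assms in auto)

lemma high_majorant_ge:
  assumes "0 \<le> z" "z \<le> 1/2"
  shows "high_piece (1/2 - z) \<le> high_majorant z"
proof (rule high_piece_le)
  have "0 \<le> z^2 * (7/10 + 186/5*z)" using assms by simp
  then show "(1/2 - z) * (125 + 274 * (1/2 - z) - 408 * (1/2 - z)\<^sup>2) \<le> high_majorant z * (40 * (6 * (1/2 - z) + 1))"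
    unfolding high_majorant_def by (simp add: field_simps power2_eq_square power3_eq_cube)
qed (use assms in auto)

text \<open>
  Continued to the left of \<open>1/2\<close>, the rational piece stays below the quadratic one. Hence the estimates
  for \<open>x \<ge> 1/2\<close> carry over to \<open>x\<close> slightly below \<open>1/2\<close>.
\<close>

lemma high_piece_le_mid_piece:
  assumes "0 \<le> p" "p \<le> 1/2"
  shows "high_piece (1/2 + p) \<le> mid_piece (1/2 - p)"
proof (rule high_piece_le)
  have "0 \<le> p * (3 + 14*p + (-24)*p^2 + 0*p^3)"
    by (rule mult_nonneg_nonneg[OF _ cubic_nonneg[where a=0 and b="1/2"]]) (use assms in \<open>auto simp: power_divide\<close>)
  then show "(1/2 + p) * (125 + 274 * (1/2 + p) - 408 * (1/2 + p)\<^sup>2) \<le> mid_piece (1/2 - p) * (40 * (6 * (1/2 + p) + 1))"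
    unfolding mid_piece_def by (simp add: field_simps power2_eq_square power3_eq_cube)
qed (use assms in auto)

text \<open>
  Near the right end, lower bounds that vanish at \<open>v = 0\<close> are needed. The next two lemmas provide those
  that the far regions of the two-point inequality ask for.
\<close>

lemma high_piece_ge_line:
  assumes "0 \<le> v" "v \<le> 1/4"
  shows "42/25 * v \<le> high_piece v"
proof (rule le_high_piece)
  have "0 \<le> v * (289/5 + (-646/5)*v + (-408)*v^2 + 0*v^3)"
    by (rule mult_nonneg_nonneg[OF _ cubic_nonneg[where a=0 and b="1/4"]]) (use assms in \<open>auto simp: power_divide\<close>)
  then show "42/25 * v * (40 * (6 * v + 1)) \<le> v * (125 + 274 * v - 408 * v\<^sup>2)"
    by (simp add: field_simps power2_eq_square power3_eq_cube)
qed (use assms in auto)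

lemma high_piece_ge_quadratics:
  assumes "0 \<le> v" "v \<le> 1/4"
  shows "17/20*v - 9/10*v^2 \<le> 207/500 * high_piece v" "12/5*v^2 \<le> 207/500 * high_piece v"
proof -
  have "(17/20*v - 9/10*v^2) * (500/207) \<le> high_piece v"
  proof (rule le_high_piece)
    have "0 \<le> v * (71/4 + (-13641/250)*v + 5886/125*v^2 + 0*v^3)"
      by (rule mult_nonneg_nonneg[OF _ cubic_nonneg[where a=0 and b="1/4"]]) (use assms in \<open>auto simp: power_divide\<close>)
    then show "(17/20*v - 9/10*v^2) * (500/207) * (40 * (6 * v + 1)) \<le> v * (125 + 274 * v - 408 * v\<^sup>2)"
      by (simp add: field_simps power2_eq_square power3_eq_cube)
  qed (use assms in auto)
  then show "17/20*v - 9/10*v^2 \<le> 207/500 * high_piece v" by simp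
  have "(12/5*v^2) * (500/207) \<le> high_piece v"
  proof (rule le_high_piece)
    have "0 \<le> v * (207/4 + 4359/250*v + (-93114/125)*v^2 + 0*v^3)"
      by (rule mult_nonneg_nonneg[OF _ cubic_nonneg[where a=0 and b="1/4"]]) (use assms in \<open>auto simp: power_divide\<close>)
    then show "(12/5*v^2) * (500/207) * (40 * (6 * v + 1)) \<le> v * (125 + 274 * v - 408 * v\<^sup>2)"
      by (simp add: field_simps power2_eq_square power3_eq_cube)
  qed (use assms in auto)
  then show "12/5*v^2 \<le> 207/500 * high_piece v" by simp
qed

lemma profile_0: "profile 0 = 0" and profile_1: "profile 1 = 0"
  by (simp_all add: profile_def low_piece_def high_piece_def)

lemma profile_low: "x \<le> 1/4 \<Longrightarrow> profile x = low_piece x"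
  by (simp add: profile_def)

lemma profile_mid:
  assumes "1/4 \<le> x" "x \<le> 1/2"
  shows "profile x = mid_piece x"
proof (cases "x = 1/4")
  case True
  show ?thesis unfolding True by (simp add: profile_def low_piece_def mid_piece_def power_divide)
qed (use assms in \<open>auto simp: profile_def\<close>)

lemma profile_high:
  assumes "1/2 \<le> x"
  shows "profile x = high_piece (1 - x)"
proof (cases "x = 1/2")
  case True
  show ?thesis unfolding True by (simp add: profile_def mid_piece_def high_piece_def power_divide)
qed (use assms in \<open>auto simp: profile_def\<close>)

text \<open>
  On the left half the profile is the maximum of the two quadratics. For the term \<open>- profile x\<close>
  either of them may therefore be used, which is the main source of flexibility below.
\<close>

lemma low_piece_le_mid_piece: "1/4 \<le> x \<Longrightarrow> low_piece x \<le> mid_piece x"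
proof -
  assume x: "1/4 \<le> x"
  have "mid_piece x - low_piece x = 3/5 * (x - 1/4) * (x + 1/6)"
    by (simp add: low_piece_def mid_piece_def field_simps power2_eq_square)
  then show ?thesis using x by (smt (verit) mult_nonneg_nonneg divide_nonneg_nonneg)
qed

lemma mid_piece_le_low_piece: "0 \<le> x \<Longrightarrow> x \<le> 1/4 \<Longrightarrow> mid_piece x \<le> low_piece x"
proof -
  assume x: "0 \<le> x" "x \<le> 1/4"
  have "low_piece x - mid_piece x = 3/5 * (1/4 - x) * (x + 1/6)"
    by (simp add: low_piece_def mid_piece_def field_simps power2_eq_square)
  then show ?thesis using x by (smt (verit) mult_nonneg_nonneg divide_nonneg_nonneg)
qed

lemma low_piece_le_profile: "0 \<le> x \<Longrightarrow> x \<le> 1/2 \<Longrightarrow> low_piece x \<le> profile x"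
  using low_piece_le_mid_piece[of x] profile_low[of x] profile_mid[of x] by (cases "x \<le> 1/4") auto

lemma mid_piece_le_profile: "0 \<le> x \<Longrightarrow> x \<le> 1/2 \<Longrightarrow> mid_piece x \<le> profile x"
  using mid_piece_le_low_piece[of x] profile_low[of x] profile_mid[of x] by (cases "x \<le> 1/4") auto

lemma low_piece_nonneg: "0 \<le> x \<Longrightarrow> x \<le> 1/2 \<Longrightarrow> 0 \<le> low_piece x"
proof -
  assume x: "0 \<le> x" "x \<le> 1/2"
  have "low_piece x = x * (2 - 12/5*x)" by (simp add: low_piece_def algebra_simps power2_eq_square)
  then show ?thesis using x by simp
qed

lemma high_piece_nonneg: "0 \<le> v \<Longrightarrow> v \<le> 1/2 \<Longrightarrow> 0 \<le> high_piece v"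
  unfolding high_piece_def by (intro mult_nonneg_nonneg) (auto intro!: add_nonneg_nonneg)

lemma profile_nonneg: "0 \<le> x \<Longrightarrow> x \<le> 1 \<Longrightarrow> 0 \<le> profile x"
  using low_piece_nonneg[of x] low_piece_le_profile[of x] high_piece_nonneg[of "1 - x"] profile_high[of x]
  by (cases "x \<le> 1/2") auto

text \<open>
  By symmetry \<open>p \<le> 1/2\<close>, and then one term comes from a quadratic piece and the other from the rational one.
  After multiplication by the denominator a cubic remains, divisible by \<open>p\<close> for the lower piece and by
  \<open>1/2 - p\<close> for the middle one because of the equality at these points.
\<close>

lemma profile_sum:
  assumes "0 \<le> p" "p \<le> 1"
  shows "4 * p * (1 - p) \<le> profile p + profile (1 - p)"
proof -
  have *: "4 * p * (1 - p) \<le> profile p + profile (1 - p)" if p: "0 \<le> p" "p \<le> 1/2" for p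
  proof (cases "p \<le> 1/4")
    case True
    have "4 * p * (1 - p) - low_piece p \<le> high_piece p"
    proof (rule le_high_piece)
      have "0 \<le> p * (45 + (-142)*p + (-24)*p^2 + 0*p^3)"
        by (rule mult_nonneg_nonneg[OF _ cubic_nonneg[where a=0 and b="1/4"]]) (use p True in \<open>auto simp: power_divide\<close>)
      then show "(4 * p * (1 - p) - low_piece p) * (40 * (6 * p + 1)) \<le> p * (125 + 274 * p - 408 * p\<^sup>2)"
        by (simp add: low_piece_def field_simps power2_eq_square power3_eq_cube)
    qed (use p in auto)
    then show ?thesis using True p profile_low[of p] profile_high[of "1 - p"] by simp
  next
    case False
    define z where "z = 1/2 - p"
    have z: "0 \<le> z" "z \<le> 1/4" "p = 1/2 - z" using p False by (auto simp: z_def)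
    have "4 * p * (1 - p) - mid_piece p \<le> high_piece p"
    proof (rule le_high_piece)
      have "0 \<le> z * (3 + 50*z + (-120)*z^2 + 0*z^3)"
        by (rule mult_nonneg_nonneg[OF _ cubic_nonneg[where a=0 and b="1/4"]]) (use z in \<open>auto simp: power_divide\<close>)
      then show "(4 * p * (1 - p) - mid_piece p) * (40 * (6 * p + 1)) \<le> p * (125 + 274 * p - 408 * p\<^sup>2)"
        unfolding z(3) by (simp add: mid_piece_def field_simps power2_eq_square power3_eq_cube)
    qed (use p in auto)
    then show ?thesis using False p profile_mid[of p] profile_high[of "1 - p"] by simp
  qed
  show ?thesis
  proof (cases "p \<le> 1/2")
    case False
    then have "4 * (1 - p) * (1 - (1 - p)) \<le> profile (1 - p) + profile (1 - (1 - p))"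
      using assms by (intro *) auto
    then show ?thesis by (simp add: algebra_simps)
  qed (use * assms in auto)
qed

lemmas mid_low_interpolate = quadratic_interpolate[where F=mid_piece and H=low_piece and
    a="-1/40" and b="39/20" and c="-9/5" and a'=0 and b'=2 and c'="-12/5"]
lemmas majorant_low_interpolate = quadratic_interpolate[where F="\<lambda>t. high_majorant (t - 1/2)" and H=low_piece and
    a="-77/1600" and b="1619/800" and c="-371/200" and a'=0 and b'=2 and c'="-12/5"]
lemmas majorant_mid_interpolate = quadratic_interpolate[where F="\<lambda>t. high_majorant (t - 1/2)" and H=mid_piece and
    a="-77/1600" and b="1619/800" and c="-371/200" and a'="-1/40" and b'="39/20" and c'="-9/5"]

section \<open>The two-point inequality on the left half\<close>

text \<open>
  For a quadratic, \<open>2 Q((x+y)/2) - Q(x)\<close> is \<open>Q(y)\<close> plus a multiple of \<open>(y-x)\<^sup>2\<close>. This is the form that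
  \<open>circle_interpolate\<close> applies to.
\<close>

lemma low_piece_second_difference: "2 * low_piece ((x + y) / 2) - low_piece x = low_piece y + 6/5 * (y - x)\<^sup>2"
  by (simp add: low_piece_def field_simps power2_eq_square)

lemma mid_piece_second_difference: "2 * mid_piece ((x + y) / 2) - mid_piece x = mid_piece y + 9/10 * (y - x)\<^sup>2"
  by (simp add: mid_piece_def field_simps power2_eq_square)

text \<open>
  If the midpoint belongs to the lower piece, the squared inequality can be interpolated in \<open>(y-x)\<^sup>2\<close>
  between \<open>0\<close> and \<open>y\<^sup>2\<close>. If it belongs to the middle piece, this still works for \<open>y - x \<le> 7/20\<close> with
  \<open>mid_piece x\<close> as lower bound for \<open>profile x\<close>. For larger \<open>y - x\<close> the point \<open>x\<close> is well below \<open>1/4\<close>, where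
  \<open>low_piece x\<close> is the better bound. The extreme case is \<open>x = 0\<close>, \<open>y = 1/2\<close>, a codimension two subcube.
\<close>

lemma two_point_left:
  assumes "0 \<le> x" "x \<le> y" "y \<le> 1/2"
  shows "2 * profile ((x + y) / 2) - profile x \<le> gain (profile y) (y - x)"
proof (cases "(x + y) / 2 \<le> 1/4")
  case True
  have S: "2 * profile ((x + y) / 2) - profile x \<le> low_piece y + 6/5 * (y - x)\<^sup>2"
    using low_piece_le_profile[of x] assms True profile_low[OF True] low_piece_second_difference[of x y] by simp
  have D1: "(low_piece y + 6/5 * y\<^sup>2)\<^sup>2 \<le> (profile y)\<^sup>2 + y\<^sup>2"
  proof (cases "y \<le> 1/4")
    case True
    have "0 \<le> 1 + (-24/5)*y + 108/25*y^2 + 0*y^3"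
      by (rule cubic_nonneg[where a="0" and b="1/4"]) (use True assms in \<open>simp_all add: power_divide\<close>)
    then have "0 \<le> y^2 * (1 + (-24/5)*y + 108/25*y^2)" by simp
    then show ?thesis using True
      by (simp add: profile_low low_piece_def field_simps power2_eq_square)
  next
    case False
    show ?thesis
    proof (rule circle_of_tangent[where \<alpha>="4/5" and \<beta>="3/5"])
      show "0 \<le> low_piece y + 6/5 * y\<^sup>2" using low_piece_nonneg[of y] assms by simp
      have "0 \<le> (-1/50) + 4/25*y + (-6/25)*y^2 + 0*y^3"
        by (rule cubic_nonneg[where a="1/4" and b="1/2"]) (use False assms in \<open>simp_all add: power_divide\<close>)
      then show "low_piece y + 6/5 * y\<^sup>2 \<le> 4/5 * profile y + 3/5 * y"
        using False assms by (simp add: profile_mid low_piece_def mid_piece_def field_simps power2_eq_square)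
    qed (simp add: power_divide)
  qed
  have "(low_piece y + 6/5 * (y - x)\<^sup>2)\<^sup>2 \<le> (profile y)\<^sup>2 + (y - x)\<^sup>2"
  proof (rule circle_interpolate[where ?D0.0=0 and ?D1.0="y\<^sup>2"])
    show "(low_piece y + 6/5 * 0)\<^sup>2 \<le> (profile y)\<^sup>2 + 0"
      using low_piece_le_profile[of y] low_piece_nonneg[of y] assms by (simp add: power_mono)
    show "(y - x)\<^sup>2 \<le> y\<^sup>2" using assms by (intro power_mono) auto
  qed (use D1 in auto)
  then show ?thesis using S gain_ge_circle by fastforce
next
  case False
  then have y: "1/4 \<le> y" "y \<le> 1/2" using assms by auto
  have b: "profile y = mid_piece y" "profile ((x + y) / 2) = mid_piece ((x + y) / 2)"
    using y False assms by (auto intro!: profile_mid)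
  show ?thesis
  proof (cases "y - x \<le> 7/20")
    case True
    have S: "2 * profile ((x + y) / 2) - profile x \<le> mid_piece y + 9/10 * (y - x)\<^sup>2"
      using mid_piece_le_profile[of x] assms mid_piece_second_difference[of x y] b(2) by simp
    have D: "0 \<le> (y - x)\<^sup>2" "(y - x)\<^sup>2 \<le> (7/20)\<^sup>2" using True assms by (auto intro!: power_mono)
    have le: "mid_piece y \<le> 1/2" using y
    proof -
      have "0 \<le> 21/40 + (-39/20)*y + 9/5*y^2 + 0*y^3"
        by (rule cubic_nonneg[where a="1/4" and b="1/2"]) (use y in \<open>simp_all add: power_divide\<close>)
      then show ?thesis by (simp add: mid_piece_def)
    qed
    have "0 \<le> (y - x)\<^sup>2 * (1 - 9/5 * mid_piece y - 81/100 * (y - x)\<^sup>2)"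
      using D le by (intro mult_nonneg_nonneg) (auto simp: power_divide)
    then have "(mid_piece y + 9/10 * (y - x)\<^sup>2)\<^sup>2 \<le> (mid_piece y)\<^sup>2 + (y - x)\<^sup>2"
      by (simp add: algebra_simps power2_sum power_mult_distrib power2_eq_square[of "(y-x)\<^sup>2"] power_divide)
    then show ?thesis using S gain_ge_circle b(1) by fastforce
  next
    case far: False
    have yy: "17/40 \<le> y" using far False by simp
    have "2 * mid_piece ((x + y) / 2) - low_piece x \<le> 7/10 * mid_piece y + 7/10 * (y - x)"
    proof (rule mid_low_interpolate[where ?x0.0="1/2 - y" and ?x1.0="y - 7/20"])
      have "0 \<le> (-267/400) + 633/200*y + (-183/50)*y^2 + 0*y^3"
        by (rule cubic_nonneg[where a="17/40" and b="1/2"]) (use yy y in \<open>simp_all add: power_divide\<close>)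
      then show "2 * mid_piece ((1/2 - y + y) / 2) - low_piece (1/2 - y) \<le> 7/10 * mid_piece y + 7/10 * (y - (1/2 - y))"
        by (simp add: piece_defs field_simps power2_eq_square power3_eq_cube)
      have "0 \<le> 61/800 + (-23/200)*y + (-3/50)*y^2 + 0*y^3"
        by (rule cubic_nonneg[where a="17/40" and b="1/2"]) (use yy y in \<open>simp_all add: power_divide\<close>)
      then show "2 * mid_piece ((y - 7/20 + y) / 2) - low_piece (y - 7/20) \<le> 7/10 * mid_piece y + 7/10 * (y - (y - 7/20))"
        by (simp add: piece_defs field_simps power2_eq_square power3_eq_cube)
    qed (use far False in \<open>auto simp: mid_piece_def low_piece_def\<close>)
    then have "2 * mid_piece ((x + y) / 2) - low_piece x \<le> gain (mid_piece y) (y - x)"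
      by (intro gain_ge_tangent[where \<alpha>="7/10" and \<beta>="7/10"]) (auto simp: power_divide)
    then show ?thesis using low_piece_le_profile[of x] assms b by simp
  qed
qed

section \<open>The two-point inequality with midpoint at most one half\<close>

lemma high_minorant_nonneg: "0 \<le> z \<Longrightarrow> z \<le> 1/4 \<Longrightarrow> 0 \<le> high_minorant z"
proof -
  assume z: "0 \<le> z" "z \<le> 1/4"
  have "0 \<le> 1/2 + 27/160*z + (-93/50)*z^2 + (-19/50)*z^3"
    by (rule cubic_nonneg[where a="0" and b="1/4"]) (use z in \<open>simp_all add: power_divide\<close>)
  then show ?thesis by (simp add: piece_defs field_simps power2_eq_square power3_eq_cube)
qed

text \<open>
  Here \<open>y = 1/2 + z\<close>, and \<open>d = y - x\<close> starts at \<open>2 z\<close> because the midpoint is at most \<open>1/2\<close>. The squared inequality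
  is interpolated between \<open>d = 2 z\<close>, where it is checked once and for all, and an end point \<open>d1\<close> that is
  left to the application.
\<close>

lemma straddle_near:
  assumes z: "0 \<le> z" "z \<le> 1/4" and d: "2*z \<le> d" "d \<le> d1"
    and tangent: "\<alpha>\<^sup>2 + \<beta>\<^sup>2 \<le> 1" "mid_piece (1/2 + z) + 9/10 * d1\<^sup>2 \<le> \<alpha> * high_minorant z + \<beta> * d1"
  shows "mid_piece (1/2 + z) + 9/10 * d\<^sup>2 \<le> gain (high_minorant z) d"
proof (rule gain_ge_circle, rule circle_interpolate[where ?D0.0="(2*z)\<^sup>2" and ?D1.0="d1\<^sup>2"])
  let ?S = "mid_piece (1/2 + z) + 9/10 * (2*z)\<^sup>2" and ?U = "high_minorant z"
  have mid0: "0 \<le> mid_piece (1/2 + z)"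
  proof -
    have "0 \<le> 1/2 + 3/20*z + (-9/5)*z^2 + 0*z^3"
      by (rule cubic_nonneg[where a="0" and b="1/4"]) (use z in \<open>simp_all add: power_divide\<close>)
    then show ?thesis by (simp add: piece_defs field_simps power2_eq_square power3_eq_cube)
  qed
  \<comment> \<open>At \<open>d = 2 z\<close> both sides agree for \<open>z = 0\<close>, so a factor \<open>z\<close> is split off from the difference of squares.\<close>
  define g where "g = -3/160 + 183/50*z + 19/50*z^2"
  have diff: "?S - ?U = z * g" and sum: "?S + ?U \<le> 1 + 51/160*z" "0 \<le> ?S + ?U"
  proof -
    show "?S - ?U = z * g" by (simp add: g_def mid_piece_def high_minorant_def field_simps power2_eq_square power3_eq_cube)
    have "0 \<le> z^2 * (3/50 + 19/50*z)" using z by simp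
    then show "?S + ?U \<le> 1 + 51/160*z" by (simp add: piece_defs field_simps power2_eq_square power3_eq_cube)
    show "0 \<le> ?S + ?U" using mid0 high_minorant_nonneg[OF z] by simp
  qed
  have "g * (?S + ?U) \<le> 4 * z"
  proof (cases "0 \<le> g")
    case True
    have "g * (?S + ?U) \<le> g * (1 + 51/160*z)" using True sum by (intro mult_left_mono)
    also have "\<dots> \<le> 4 * z"
    proof -
      have "0 \<le> 3/160 + 8857/25600*z + (-12373/8000)*z^2 + (-969/8000)*z^3"
        by (rule cubic_nonneg[where a="0" and b="1/4"]) (use z in \<open>simp_all add: power_divide\<close>)
      then show ?thesis by (simp add: g_def field_simps power2_eq_square power3_eq_cube)
    qed
    finally show ?thesis .
  next
    case False
    then have "g * (?S + ?U) \<le> 0" using sum(2) by (intro mult_nonpos_nonneg) auto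
    then show ?thesis using z by simp
  qed
  then have "z * (g * (?S + ?U)) \<le> z * (4 * z)" using z by (intro mult_left_mono)
  moreover have "(?S - ?U) * (?S + ?U) = z * (g * (?S + ?U))" by (simp only: diff mult.assoc)
  ultimately have "(?S - ?U) * (?S + ?U) \<le> (2*z)\<^sup>2" by (simp only: power2_eq_square)
  then show "?S\<^sup>2 \<le> ?U\<^sup>2 + (2*z)\<^sup>2" by (simp add: power2_eq_square algebra_simps)
  show "(mid_piece (1/2 + z) + 9/10 * d1\<^sup>2)\<^sup>2 \<le> ?U\<^sup>2 + d1\<^sup>2"
  proof (rule circle_of_tangent[OF tangent(1) _ tangent(2)])
    show "0 \<le> mid_piece (1/2 + z) + 9/10 * d1\<^sup>2" using mid0 by simp
  qed
  show "(2*z)\<^sup>2 \<le> d\<^sup>2" "d\<^sup>2 \<le> d1\<^sup>2" using z d by (intro power_mono; simp)+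
qed

text \<open>
  Away from the diagonal \<open>low_piece x\<close> replaces \<open>mid_piece x\<close>, and the circle is replaced by one of its tangents.
\<close>

lemma straddle_mixed:
  assumes x: "x0 \<le> x" "x \<le> x1" and tangent: "\<alpha>\<^sup>2 + \<beta>\<^sup>2 \<le> 1"
    and ends: "2 * mid_piece ((x0 + (1/2 + z)) / 2) - low_piece x0 \<le> \<alpha> * high_minorant z + \<beta> * (1/2 + z - x0)"
      "2 * mid_piece ((x1 + (1/2 + z)) / 2) - low_piece x1 \<le> \<alpha> * high_minorant z + \<beta> * (1/2 + z - x1)"
  shows "2 * mid_piece ((x + (1/2 + z)) / 2) - low_piece x \<le> gain (high_minorant z) (1/2 + z - x)"
  by (rule gain_ge_tangent[OF tangent], rule mid_low_interpolate[where ?x0.0=x0 and ?x1.0=x1])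
     (use x ends in \<open>auto simp: mid_piece_def low_piece_def\<close>)

text \<open>
  The same with the linear part of the gain, for \<open>x\<close> in a range starting at \<open>0\<close>.
\<close>

lemma straddle_linear:
  assumes z: "0 \<le> z" "z \<le> 1/4" and x: "0 \<le> x" "x \<le> x1"
    and ends: "2 * mid_piece ((x1 + (1/2 + z)) / 2) - low_piece x1 \<le> 207/500 * high_minorant z + (1/2 + z - x1)"
  shows "2 * mid_piece ((x + (1/2 + z)) / 2) - low_piece x \<le> gain (high_minorant z) (1/2 + z - x)"
proof -
  have "0 \<le> 7/1000 + 1589/80000*z + 3249/25000*z^2 + (-3933/25000)*z^3"
    by (rule cubic_nonneg[where a="0" and b="1/4"]) (use z in \<open>simp_all add: power_divide\<close>)
  then have x0: "2 * mid_piece ((0 + (1/2 + z)) / 2) - low_piece 0 \<le> 207/500 * high_minorant z + 1 * (1/2 + z - 0)"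
    by (simp add: piece_defs field_simps power2_eq_square power3_eq_cube)
  have "2 * mid_piece ((x + (1/2 + z)) / 2) - low_piece x \<le> 207/500 * high_minorant z + 1 * (1/2 + z - x)"
    by (rule mid_low_interpolate[OF _ _ _ x0])
       (use x ends in \<open>auto simp: mid_piece_def low_piece_def\<close>)
  then show ?thesis using gain_ge_linear high_minorant_nonneg[OF z] by (simp add: add.commute)
qed

text \<open>
  For fixed \<open>y = 1/2 + z\<close> the range of \<open>x\<close> is cut into at most three parts: \<open>straddle_near\<close> for large \<open>x\<close>, a
  tangent adapted to \<open>d\<close> slightly less than \<open>b\<close> in the middle, and the linear part of the gain for \<open>x \<le> z\<close>, that is
  \<open>d \<ge> 1/2\<close>. The two estimates that meet at the first cut overlap only in a narrow strip of the \<open>(z, d)\<close>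
  plane, which forces the cut to be a broken line in \<open>z\<close>; hence the six cases. From \<open>z = 1/5\<close> on
  the middle part is not needed.
\<close>

lemma straddle:
  assumes zz: "0 \<le> z" "z \<le> 1/4" and x: "0 \<le> x" "x \<le> 1/2 - z"
  shows "2 * mid_piece ((x + (1/2 + z)) / 2) - profile x \<le> gain (high_minorant z) (1/2 + z - x)"
proof -
  have near_case: ?thesis if "mid_piece (1/2 + z) + 9/10 * (1/2 + z - x)\<^sup>2 \<le> gain (high_minorant z) (1/2 + z - x)"
    using that mid_piece_le_profile[of x] x zz mid_piece_second_difference[of x "1/2 + z"] by simp
  have far_case: ?thesis if "2 * mid_piece ((x + (1/2 + z)) / 2) - low_piece x \<le> gain (high_minorant z) (1/2 + z - x)"
    using that low_piece_le_profile[of x] x zz by simp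
  have linear: ?thesis if "x \<le> z" "z \<le> 1/5"
  proof -
    have "0 \<le> 7/1000 + (-2411/80000)*z + 10749/25000*z^2 + (-3933/25000)*z^3"
      by (rule cubic_nonneg[where a="0" and b="1/5"]) (use zz that in \<open>simp_all add: power_divide\<close>)
    then have "2 * mid_piece ((z + (1/2 + z)) / 2) - low_piece z \<le> 207/500 * high_minorant z + (1/2 + z - z)"
      by (simp add: piece_defs field_simps power2_eq_square power3_eq_cube)
    then show ?thesis by (intro far_case straddle_linear[OF _ _ _ that(1)]) (use zz x in auto)
  qed
  consider (a) "0 \<le> z \<and> z \<le> 1/10" | (b) "1/10 \<le> z \<and> z \<le> 13/100" | (c) "13/100 \<le> z \<and> z \<le> 4/25"
    | (d) "4/25 \<le> z \<and> z \<le> 9/50" | (e) "9/50 \<le> z \<and> z \<le> 1/5" | (f) "1/5 \<le> z \<and> z \<le> 1/4"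
    using zz by linarith
  then show ?thesis
  proof cases
    case a
    have z: "0 \<le> z" "z \<le> 1/10" using a by auto
    have near: ?thesis if "1/2 + z - (33/100 + 33/100*z) \<le> x"
    proof -
      have "0 \<le> 93/100000 + (-15759/800000)*z + 17121/100000*z^2 + (-15637/50000)*z^3"
        by (rule cubic_nonneg[where a="0" and b="1/10"]) (use z in \<open>simp_all add: power_divide\<close>)
      then have "mid_piece (1/2 + z) + 9/10 * (33/100 + 33/100*z)\<^sup>2 \<le> 823/1000 * high_minorant z + 71/125 * (33/100 + 33/100*z)"
        by (simp add: piece_defs field_simps power2_eq_square power3_eq_cube)
      then show ?thesis using that x z
        by (intro near_case straddle_near[where ?d1.0="(33/100 + 33/100*z)" and \<alpha>="823/1000" and \<beta>="71/125"])
           (auto simp: power_divide)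
    qed
    have middle: ?thesis if "z \<le> x" "x \<le> 1/2 + z - (33/100 + 33/100*z)"
    proof -
      have "0 \<le> 11/2000 + 17/640*z + (-39/200)*z^2 + (-57/200)*z^3"
        by (rule cubic_nonneg[where a="0" and b="1/10"]) (use z in \<open>simp_all add: power_divide\<close>)
      then have 1: "2 * mid_piece ((z + (1/2 + z)) / 2) - low_piece z \<le> 3/4 * high_minorant z + 661/1000 * (1/2 + z - z)"
        by (simp add: piece_defs field_simps power2_eq_square power3_eq_cube)
      have "0 \<le> 141/12500 + (-41803/400000)*z + 753/20000*z^2 + (-57/200)*z^3"
        by (rule cubic_nonneg[where a="0" and b="1/10"]) (use z in \<open>simp_all add: power_divide\<close>)
      then have 2: "2 * mid_piece ((1/2 + z - (33/100 + 33/100*z) + (1/2 + z)) / 2) - low_piece (1/2 + z - (33/100 + 33/100*z))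
          \<le> 3/4 * high_minorant z + 661/1000 * (1/2 + z - (1/2 + z - (33/100 + 33/100*z)))"
        by (simp add: piece_defs field_simps power2_eq_square power3_eq_cube)
      show ?thesis
        by (rule far_case, rule straddle_mixed[OF that _ 1 2]) (use z in \<open>auto simp: power_divide\<close>)
    qed
    show ?thesis using near middle linear z by argo
  next
    case b
    have z: "1/10 \<le> z" "z \<le> 13/100" using b by auto
    have near: ?thesis if "1/2 + z - (57/200 + 79/100*z) \<le> x"
    proof -
      have "0 \<le> (-1359/400000) + 997/16000*z + (-23109/100000)*z^2 + (-1501/5000)*z^3"
        by (rule cubic_nonneg[where a="1/10" and b="13/100"]) (use z in \<open>simp_all add: power_divide\<close>)
      then have "mid_piece (1/2 + z) + 9/10 * (57/200 + 79/100*z)\<^sup>2 \<le> 79/100 * high_minorant z + 613/1000 * (57/200 + 79/100*z)"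
        by (simp add: piece_defs field_simps power2_eq_square power3_eq_cube)
      then show ?thesis using that x z
        by (intro near_case straddle_near[where ?d1.0="(57/200 + 79/100*z)" and \<alpha>="79/100" and \<beta>="613/1000"])
           (auto simp: power_divide)
    qed
    have middle: ?thesis if "z \<le> x" "x \<le> 1/2 + z - (57/200 + 79/100*z)"
    proof -
      have "0 \<le> 11/2000 + 17/640*z + (-39/200)*z^2 + (-57/200)*z^3"
        by (rule cubic_nonneg[where a="1/10" and b="13/100"]) (use z in \<open>simp_all add: power_divide\<close>)
      then have 1: "2 * mid_piece ((z + (1/2 + z)) / 2) - low_piece z \<le> 3/4 * high_minorant z + 661/1000 * (1/2 + z - z)"
        by (simp add: piece_defs field_simps power2_eq_square power3_eq_cube)
      have "0 \<le> (-681/400000) + 19921/400000*z + (-3663/20000)*z^2 + (-57/200)*z^3"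
        by (rule cubic_nonneg[where a="1/10" and b="13/100"]) (use z in \<open>simp_all add: power_divide\<close>)
      then have 2: "2 * mid_piece ((1/2 + z - (57/200 + 79/100*z) + (1/2 + z)) / 2) - low_piece (1/2 + z - (57/200 + 79/100*z))
          \<le> 3/4 * high_minorant z + 661/1000 * (1/2 + z - (1/2 + z - (57/200 + 79/100*z)))"
        by (simp add: piece_defs field_simps power2_eq_square power3_eq_cube)
      show ?thesis
        by (rule far_case, rule straddle_mixed[OF that _ 1 2]) (use z in \<open>auto simp: power_divide\<close>)
    qed
    show ?thesis using near middle linear z by argo
  next
    case c
    have z: "13/100 \<le> z" "z \<le> 4/25" using c by auto
    have near: ?thesis if "1/2 + z - (57/200 + 79/100*z) \<le> x"
    proof -
      have "0 \<le> (-2509/400000) + 1259/16000*z + (-19389/100000)*z^2 + (-1463/5000)*z^3"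
        by (rule cubic_nonneg[where a="13/100" and b="4/25"]) (use z in \<open>simp_all add: power_divide\<close>)
      then have "mid_piece (1/2 + z) + 9/10 * (57/200 + 79/100*z)\<^sup>2 \<le> 77/100 * high_minorant z + 319/500 * (57/200 + 79/100*z)"
        by (simp add: piece_defs field_simps power2_eq_square power3_eq_cube)
      then show ?thesis using that x z
        by (intro near_case straddle_near[where ?d1.0="(57/200 + 79/100*z)" and \<alpha>="77/100" and \<beta>="319/500"])
           (auto simp: power_divide)
    qed
    have middle: ?thesis if "z \<le> x" "x \<le> 1/2 + z - (57/200 + 79/100*z)"
    proof -
      have "0 \<le> 11/2000 + 17/640*z + (-39/200)*z^2 + (-57/200)*z^3"
        by (rule cubic_nonneg[where a="13/100" and b="4/25"]) (use z in \<open>simp_all add: power_divide\<close>)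
      then have 1: "2 * mid_piece ((z + (1/2 + z)) / 2) - low_piece z \<le> 3/4 * high_minorant z + 661/1000 * (1/2 + z - z)"
        by (simp add: piece_defs field_simps power2_eq_square power3_eq_cube)
      have "0 \<le> (-681/400000) + 19921/400000*z + (-3663/20000)*z^2 + (-57/200)*z^3"
        by (rule cubic_nonneg[where a="13/100" and b="4/25"]) (use z in \<open>simp_all add: power_divide\<close>)
      then have 2: "2 * mid_piece ((1/2 + z - (57/200 + 79/100*z) + (1/2 + z)) / 2) - low_piece (1/2 + z - (57/200 + 79/100*z))
          \<le> 3/4 * high_minorant z + 661/1000 * (1/2 + z - (1/2 + z - (57/200 + 79/100*z)))"
        by (simp add: piece_defs field_simps power2_eq_square power3_eq_cube)
      show ?thesis
        by (rule far_case, rule straddle_mixed[OF that _ 1 2]) (use z in \<open>auto simp: power_divide\<close>)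
    qed
    show ?thesis using near middle linear z by argo
  next
    case d
    have z: "4/25 \<le> z" "z \<le> 9/50" using d by auto
    have near: ?thesis if "1/2 + z - (32/125 + 39/40*z) \<le> x"
    proof -
      have "0 \<le> (-19663/1250000) + 141411/800000*z + (-35301/80000)*z^2 + (-2831/10000)*z^3"
        by (rule cubic_nonneg[where a="4/25" and b="9/50"]) (use z in \<open>simp_all add: power_divide\<close>)
      then have "mid_piece (1/2 + z) + 9/10 * (32/125 + 39/40*z)\<^sup>2 \<le> 149/200 * high_minorant z + 667/1000 * (32/125 + 39/40*z)"
        by (simp add: piece_defs field_simps power2_eq_square power3_eq_cube)
      then show ?thesis using that x z
        by (intro near_case straddle_near[where ?d1.0="(32/125 + 39/40*z)" and \<alpha>="149/200" and \<beta>="667/1000"])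
           (auto simp: power_divide)
    qed
    have middle: ?thesis if "z \<le> x" "x \<le> 1/2 + z - (32/125 + 39/40*z)"
    proof -
      have "0 \<le> 3/500 + 199/8000*z + (-441/2500)*z^2 + (-703/2500)*z^3"
        by (rule cubic_nonneg[where a="4/25" and b="9/50"]) (use z in \<open>simp_all add: power_divide\<close>)
      then have 1: "2 * mid_piece ((z + (1/2 + z)) / 2) - low_piece z \<le> 37/50 * high_minorant z + 84/125 * (1/2 + z - z)"
        by (simp add: piece_defs field_simps power2_eq_square power3_eq_cube)
      have "0 \<le> (-967/62500) + 6989/40000*z + (-34587/80000)*z^2 + (-703/2500)*z^3"
        by (rule cubic_nonneg[where a="4/25" and b="9/50"]) (use z in \<open>simp_all add: power_divide\<close>)
      then have 2: "2 * mid_piece ((1/2 + z - (32/125 + 39/40*z) + (1/2 + z)) / 2) - low_piece (1/2 + z - (32/125 + 39/40*z))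
          \<le> 37/50 * high_minorant z + 84/125 * (1/2 + z - (1/2 + z - (32/125 + 39/40*z)))"
        by (simp add: piece_defs field_simps power2_eq_square power3_eq_cube)
      show ?thesis
        by (rule far_case, rule straddle_mixed[OF that _ 1 2]) (use z in \<open>auto simp: power_divide\<close>)
    qed
    show ?thesis using near middle linear z by argo
  next
    case e
    have z: "9/50 \<le> z" "z \<le> 1/5" using e by auto
    have near: ?thesis if "1/2 + z - (119/500 + 43/40*z) \<le> x"
    proof -
      have "0 \<le> (-32587/1250000) + 206341/800000*z + (-230961/400000)*z^2 + (-13661/50000)*z^3"
        by (rule cubic_nonneg[where a="9/50" and b="1/5"]) (use z in \<open>simp_all add: power_divide\<close>)
      then have "mid_piece (1/2 + z) + 9/10 * (119/500 + 43/40*z)\<^sup>2 \<le> 719/1000 * high_minorant z + 139/200 * (119/500 + 43/40*z)"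
        by (simp add: piece_defs field_simps power2_eq_square power3_eq_cube)
      then show ?thesis using that x z
        by (intro near_case straddle_near[where ?d1.0="(119/500 + 43/40*z)" and \<alpha>="719/1000" and \<beta>="139/200"])
           (auto simp: power_divide)
    qed
    have middle: ?thesis if "z \<le> x" "x \<le> 1/2 + z - (119/500 + 43/40*z)"
    proof -
      have "0 \<le> 3/500 + 199/8000*z + (-441/2500)*z^2 + (-703/2500)*z^3"
        by (rule cubic_nonneg[where a="9/50" and b="1/5"]) (use z in \<open>simp_all add: power_divide\<close>)
      then have 1: "2 * mid_piece ((z + (1/2 + z)) / 2) - low_piece z \<le> 37/50 * high_minorant z + 84/125 * (1/2 + z - z)"
        by (simp add: piece_defs field_simps power2_eq_square power3_eq_cube)
      have "0 \<le> (-2413/100000) + 10263/40000*z + (-49587/80000)*z^2 + (-703/2500)*z^3"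
        by (rule cubic_nonneg[where a="9/50" and b="1/5"]) (use z in \<open>simp_all add: power_divide\<close>)
      then have 2: "2 * mid_piece ((1/2 + z - (119/500 + 43/40*z) + (1/2 + z)) / 2) - low_piece (1/2 + z - (119/500 + 43/40*z))
          \<le> 37/50 * high_minorant z + 84/125 * (1/2 + z - (1/2 + z - (119/500 + 43/40*z)))"
        by (simp add: piece_defs field_simps power2_eq_square power3_eq_cube)
      show ?thesis
        by (rule far_case, rule straddle_mixed[OF that _ 1 2]) (use z in \<open>auto simp: power_divide\<close>)
    qed
    show ?thesis using near middle linear z by argo
  next
    case f
    have z: "1/5 \<le> z" "z \<le> 1/4" using f by auto
    have near: ?thesis if "1/2 + z - (2687/10000 + 37/40*z) \<le> x"
    proof -
      have "0 \<le> (-20583621/1000000000) + 691483/4000000*z + (-117009/400000)*z^2 + (-13509/50000)*z^3"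
        by (rule cubic_nonneg[where a="1/5" and b="1/4"]) (use z in \<open>simp_all add: power_divide\<close>)
      then have "mid_piece (1/2 + z) + 9/10 * (2687/10000 + 37/40*z)\<^sup>2 \<le> 711/1000 * high_minorant z + 703/1000 * (2687/10000 + 37/40*z)"
        by (simp add: piece_defs field_simps power2_eq_square power3_eq_cube)
      then show ?thesis using that x z
        by (intro near_case straddle_near[where ?d1.0="(2687/10000 + 37/40*z)" and \<alpha>="711/1000" and \<beta>="703/1000"])
           (auto simp: power_divide)
    qed
    have far: ?thesis if "x \<le> 1/2 + z - (2687/10000 + 37/40*z)"
    proof -
      have "0 \<le> (-16962907/200000000) + 38041/100000*z + 102609/400000*z^2 + (-3933/25000)*z^3"
        by (rule cubic_nonneg[where a="1/5" and b="1/4"]) (use z in \<open>simp_all add: power_divide\<close>)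
      then have "2 * mid_piece ((1/2 + z - (2687/10000 + 37/40*z) + (1/2 + z)) / 2) - low_piece (1/2 + z - (2687/10000 + 37/40*z))
          \<le> 207/500 * high_minorant z + (1/2 + z - (1/2 + z - (2687/10000 + 37/40*z)))"
        by (simp add: piece_defs field_simps power2_eq_square power3_eq_cube)
      then show ?thesis by (intro far_case straddle_linear[OF _ _ _ that]) (use z x in auto)
    qed
    show ?thesis using near far by argo
  qed
qed

text \<open>
  For \<open>y \<ge> 3/4\<close> the distance \<open>y - x\<close> is at least \<open>1/2\<close> and exceeds \<open>profile y\<close>, so the linear part of the
  gain suffices for all \<open>x\<close>. The slope of the profile at \<open>1\<close> has to be steep for this: the pair
  \<open>x = 0\<close>, \<open>y = 1\<close> gives equality.
\<close>

lemma two_point_straddle: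
  assumes "0 \<le> x" "1/2 \<le> y" "y \<le> 1" "x + y \<le> 1"
  shows "2 * profile ((x + y) / 2) - profile x \<le> gain (profile y) (y - x)"
proof -
  have mid: "profile ((x + y) / 2) = mid_piece ((x + y) / 2)"
    using assms by (intro profile_mid) auto
  have y: "profile y = high_piece (1 - y)" using assms by (intro profile_high)
  show ?thesis
  proof (cases "y \<le> 3/4")
    case True
    define z where "z = y - 1/2"
    have z: "0 \<le> z" "z \<le> 1/4" "y = 1/2 + z" "1 - y = 1/2 - z" using True assms by (auto simp: z_def)
    have "2 * mid_piece ((x + y) / 2) - profile x \<le> gain (high_minorant z) (y - x)"
      using straddle[OF z(1,2), of x] assms unfolding z(3) by simp
    also have "\<dots> \<le> gain (high_piece (1 - y)) (y - x)"
      unfolding z(4) using high_minorant_le[OF z(1,2)] high_minorant_nonneg[OF z(1,2)] assms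
      by (intro gain_mono) auto
    finally show ?thesis by (simp add: mid y)
  next
    case False
    define v where "v = 1 - y"
    have v: "0 \<le> v" "v \<le> 1/4" "y = 1 - v" using False assms by (auto simp: v_def)
    note R = high_piece_ge_quadratics[OF v(1,2)]
    have "2 * mid_piece ((x + y) / 2) - low_piece x \<le> 207/500 * high_piece v + 1 * (y - x)"
    proof (rule mid_low_interpolate[where ?x0.0=0 and ?x1.0=v])
      show "2 * mid_piece ((0 + y) / 2) - low_piece 0 \<le> 207/500 * high_piece v + 1 * (y - 0)"
        using R(1) unfolding v(3) by (simp add: mid_piece_def low_piece_def field_simps power2_eq_square)
      show "2 * mid_piece ((v + y) / 2) - low_piece v \<le> 207/500 * high_piece v + 1 * (y - v)"
        using R(2) unfolding v(3) by (simp add: mid_piece_def low_piece_def field_simps power2_eq_square)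
    qed (use assms in \<open>auto simp: mid_piece_def low_piece_def v_def\<close>)
    then have "2 * mid_piece ((x + y) / 2) - low_piece x \<le> gain (high_piece v) (y - x)"
      using high_piece_nonneg[of v] v by (intro gain_ge_linear) auto
    then show ?thesis using low_piece_le_profile[of x] assms by (simp add: mid y v_def)
  qed
qed

section \<open>The two-point inequality with midpoint at least one half, far from the diagonal\<close>

text \<open>
  The midpoint lies in \<open>[1/2, 27/40]\<close>, where the rational piece is replaced by its quadratic majorant. The
  difference \<open>2 F((x+y)/2) - H(x)\<close> is then convex in \<open>x\<close>, and end points suffice: with the linear part of the gain
  for \<open>y \<ge> 3/4\<close>, with two tangents of the circle for \<open>y < 3/4\<close>.
\<close>

lemma two_point_far_right:
  assumes "0 \<le> x" "x \<le> 7/20" "y \<le> 1" "1 \<le> x + y"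
  shows "2 * profile ((x + y) / 2) - profile x \<le> gain (profile y) (y - x)"
proof -
  let ?V = "\<lambda>t. high_majorant (t - 1/2)"
  have mid: "profile ((x + y) / 2) \<le> ?V ((x + y) / 2)"
    using assms high_majorant_ge[of "(x + y) / 2 - 1/2"] by (simp add: profile_high)
  have y: "profile y = high_piece (1 - y)" using assms by (intro profile_high) auto
  show ?thesis
  proof (cases "3/4 \<le> y")
    case True
    define v where "v = 1 - y"
    have v: "0 \<le> v" "v \<le> 1/4" "y = 1 - v" using True assms by (auto simp: v_def)
    let ?e = "207/500 * high_piece v"
    have R: "207/500 * (42/25 * v) \<le> ?e" using high_piece_ge_line[OF v(1,2)] by simp
    have "0 \<le> 741/6400 + (-14987/25000)*v + 371/400*v^2 + 0*v^3"
      by (rule cubic_nonneg[where a="0" and b="1/4"]) (use v in \<open>simp_all add: power_divide\<close>)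
    then have quarter: "2 * ?V ((1/4 + y) / 2) - 7/20 \<le> ?e + 1 * (y - 1/4)"
      using R unfolding v(3) by (simp add: high_majorant_def field_simps power2_eq_square)
    have "2 * ?V ((x + y) / 2) - profile x \<le> ?e + 1 * (y - x)"
    proof (cases "x \<le> 1/4")
      case True
      have "2 * ?V ((x + y) / 2) - low_piece x \<le> ?e + 1 * (y - x)"
      proof (rule majorant_low_interpolate[where ?x0.0=v and ?x1.0="1/4"])
        show "2 * ?V ((v + y) / 2) - low_piece v \<le> ?e + 1 * (y - v)"
          using high_piece_ge_quadratics(2)[OF v(1,2)] unfolding v(3)
          by (simp add: high_majorant_def low_piece_def field_simps power2_eq_square)
        show "2 * ?V ((1/4 + y) / 2) - low_piece (1/4) \<le> ?e + 1 * (y - 1/4)"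
          using quarter by (simp add: low_piece_def power_divide)
      qed (use True assms v in \<open>auto simp: high_majorant_def low_piece_def field_simps power2_eq_square\<close>)
      then show ?thesis using low_piece_le_profile[of x] True assms by simp
    next
      case False
      have "2 * ?V ((x + y) / 2) - mid_piece x \<le> ?e + 1 * (y - x)"
      proof (rule majorant_mid_interpolate[where ?x0.0="1/4" and ?x1.0="7/20"])
        show "2 * ?V ((1/4 + y) / 2) - mid_piece (1/4) \<le> ?e + 1 * (y - 1/4)"
          using quarter by (simp add: mid_piece_def power_divide)
        have "0 \<le> 22649/160000 + (-39249/50000)*v + 371/400*v^2 + 0*v^3"
          by (rule cubic_nonneg[where a="0" and b="1/4"]) (use v in \<open>simp_all add: power_divide\<close>)
        then show "2 * ?V ((7/20 + y) / 2) - mid_piece (7/20) \<le> ?e + 1 * (y - 7/20)"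
          using R unfolding v(3) by (simp add: high_majorant_def mid_piece_def field_simps power2_eq_square)
      qed (use False assms v in \<open>auto simp: high_majorant_def mid_piece_def field_simps power2_eq_square\<close>)
      then show ?thesis using mid_piece_le_profile[of x] False assms by simp
    qed
    then have "2 * ?V ((x + y) / 2) - profile x \<le> gain (high_piece v) (y - x)"
      using high_piece_nonneg[of v] v by (intro gain_ge_linear) auto
    then show ?thesis using mid by (simp add: y v_def)
  next
    case False
    define z where "z = y - 1/2"
    have z: "3/20 \<le> z" "z \<le> 1/4" "y = 1/2 + z" "1 - y = 1/2 - z" using False assms by (auto simp: z_def)
    have tangent: "2 * ?V ((x + y) / 2) - mid_piece x \<le> \<alpha> * high_minorant z + \<alpha>' * (y - x)"
      if "1 - mid_piece (1/2 - z) \<le> \<alpha> * high_minorant z + \<alpha>' * (2 * z)"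
        and "2 * high_majorant ((z - 3/20) / 2) - 437/1000 \<le> \<alpha> * high_minorant z + \<alpha>' * (z + 3/20)" for \<alpha> \<alpha>'
    proof (rule majorant_mid_interpolate[where ?x0.0="1/2 - z" and ?x1.0="7/20"])
      show "2 * ?V ((1/2 - z + y) / 2) - mid_piece (1/2 - z) \<le> \<alpha> * high_minorant z + \<alpha>' * (y - (1/2 - z))"
        using that(1) unfolding z(3) by (simp add: high_majorant_def)
      have ends: "(7/20 + y) / 2 - 1/2 = (z - 3/20) / 2" "y - 7/20 = z + 3/20" "mid_piece (7/20) = 437/1000"
        unfolding z(3) by (auto simp: mid_piece_def power_divide field_simps)
      show "2 * ?V ((7/20 + y) / 2) - mid_piece (7/20) \<le> \<alpha> * high_minorant z + \<alpha>' * (y - 7/20)"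
        using that(2) by (simp only: ends)
    qed (use assms z in \<open>auto simp: high_majorant_def mid_piece_def field_simps power2_eq_square\<close>)
    have "2 * ?V ((x + y) / 2) - mid_piece x \<le> gain (high_minorant z) (y - x)"
    proof (cases "z \<le> 1/5")
      case True
      have "0 \<le> (-1/10) + 237/200*z + (-411/125)*z^2 + (-38/125)*z^3"
        by (rule cubic_nonneg[where a="3/20" and b="1/5"]) (use z True in \<open>simp_all add: power_divide\<close>)
      then have 1: "1 - mid_piece (1/2 - z) \<le> 4/5 * high_minorant z + 3/5 * (2 * z)"
        by (simp add: piece_defs field_simps power2_eq_square power3_eq_cube)
      have "0 \<le> (-4291/160000) + 36/125*z + (-1121/2000)*z^2 + (-38/125)*z^3"
        by (rule cubic_nonneg[where a="3/20" and b="1/5"]) (use z True in \<open>simp_all add: power_divide\<close>)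
      then have 2: "2 * high_majorant ((z - 3/20) / 2) - 437/1000 \<le> 4/5 * high_minorant z + 3/5 * (z + 3/20)"
        by (simp add: piece_defs field_simps power2_eq_square power3_eq_cube)
      show ?thesis by (rule gain_ge_tangent[OF _ tangent[OF 1 2]]) (simp add: power_divide)
    next
      case False
      have "0 \<le> (-293/2000) + 221329/160000*z + (-155751/50000)*z^2 + (-13433/50000)*z^3"
        by (rule cubic_nonneg[where a="1/5" and b="1/4"]) (use z False in \<open>simp_all add: power_divide\<close>)
      then have 1: "1 - mid_piece (1/2 - z) \<le> 707/1000 * high_minorant z + 707/1000 * (2 * z)"
        by (simp add: piece_defs field_simps power2_eq_square power3_eq_cube)
      have "0 \<le> (-9163/160000) + 60689/160000*z + (-1211/3125)*z^2 + (-13433/50000)*z^3"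
        by (rule cubic_nonneg[where a="1/5" and b="1/4"]) (use z False in \<open>simp_all add: power_divide\<close>)
      then have 2: "2 * high_majorant ((z - 3/20) / 2) - 437/1000 \<le> 707/1000 * high_minorant z + 707/1000 * (z + 3/20)"
        by (simp add: piece_defs field_simps power2_eq_square power3_eq_cube)
      show ?thesis by (rule gain_ge_tangent[OF _ tangent[OF 1 2]]) (simp add: power_divide)
    qed
    also have "\<dots> \<le> gain (profile y) (y - x)"
      unfolding y z(4) using high_minorant_le[of z] high_minorant_nonneg[of z] assms z
      by (intro gain_mono) auto
    finally show ?thesis using mid mid_piece_le_profile[of x] assms by simp
  qed
qed

section \<open>The two-point inequality with midpoint at least one half, near the diagonal\<close>

text \<open>
  In this form second differences are explicit. The pole contributes \<open>- (17/360) / C\<close> with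
  \<open>C = v + 1/6\<close>.
\<close>

lemma high_piece_partial_fraction:
  "0 \<le> v \<Longrightarrow> high_piece v = 57/40 * v - 17/10 * v\<^sup>2 + 17/60 - 17/360 / (v + 1/6)"
  by (simp add: high_piece_def field_simps power2_eq_square)

lemma high_piece_le_const:
  assumes "0 \<le> v" "v \<le> 1/2"
  shows "high_piece v \<le> 63/125"
proof -
  define z where "z = 1/2 - v"
  have z: "0 \<le> z" "z \<le> 1/2" "v = 1/2 - z" using assms by (auto simp: z_def)
  have "63/125 - high_majorant z = 371/200 * (z - 135/2968)\<^sup>2 + 3851/23744000"
    by (simp add: high_majorant_def field_simps power2_eq_square)
  moreover have "0 \<le> 371/200 * (z - 135/2968)\<^sup>2" by simp
  ultimately have "high_majorant z \<le> 63/125" by linarith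
  then show ?thesis using high_majorant_ge[OF z(1,2)] unfolding z(3) by simp
qed

text \<open>
  The first factor is \<open>-B''/2\<close>, so this is the local condition \<open>B B'' \<ge> -2\<close>. With \<open>c = 6 v + 1\<close> cleared from the
  denominators it becomes a sextic, which has nonnegative Bernstein coefficients on each of two
  subintervals.
\<close>

lemma high_piece_curvature_at_point:
  assumes "0 \<le> v" "v \<le> 21/50"
  shows "(17/10 + 17/360 / (v + 1/6)^3) * high_piece v \<le> 1"
proof -
  have "0 \<le> 40 + (-1055/2) * v + 7772/5 * v^2 + 40404/5 * v^3 + (-159408/5) * v^4 + (-25704) * v^5 + 749088/5 * v^6"
  proof (cases "v \<le> 1/5")
    case True
    have "40 + (-1055/2) * v + 7772/5 * v^2 + 40404/5 * v^3 + (-159408/5) * v^4 + (-25704) * v^5 + 749088/5 * v^6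
        = 625000 * (1/5 - v)^6 + 4203125/2 * v * (1/5 - v)^5 + 4208625/2 * v^2 * (1/5 - v)^4
        + 911725 * v^3 * (1/5 - v)^3 + 952885 * v^4 * (1/5 - v)^2
        + 1403025/2 * v^5 * (1/5 - v) + 1824201/10 * v^6"
      by algebra
    then show ?thesis using assms True by (auto intro!: add_nonneg_nonneg)
  next
    case False
    have "40 + (-1055/2) * v + 7772/5 * v^2 + 40404/5 * v^3 + (-159408/5) * v^4 + (-25704) * v^5 + 749088/5 * v^6
        = 182420100000/1771561 * (21/50 - v)^6 + 1526829510000/1771561 * (v - 1/5) * (21/50 - v)^5 + 5117611090000/1771561 * (v - 1/5)^2 * (21/50 - v)^4
        + 8229096712000/1771561 * (v - 1/5)^3 * (21/50 - v)^3 + 7696059494400/1771561 * (v - 1/5)^4 * (21/50 - v)^2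
        + 5876359975456/1771561 * (v - 1/5)^5 * (21/50 - v) + 14508032651648/8857805 * (v - 1/5)^6"
      by algebra
    then show ?thesis using assms False by (auto intro!: add_nonneg_nonneg)
  qed
  then have poly: "(17/10 * (6*v + 1)^3 + 51/5) * (v * (125 + 274*v - 408*v\<^sup>2)) \<le> 40 * (6*v + 1)^4"
    by (simp add: field_simps eval_nat_numeral)
  define c where "c = 6*v + 1"
  have c: "0 < c" "v + 1/6 = c / 6" using assms by (auto simp: c_def)
  have "(17/10 + 17/360 / (v + 1/6)^3) * high_piece v = (17/10 * c^3 + 51/5) * (v * (125 + 274*v - 408*v\<^sup>2)) / (40 * c^4)"
    unfolding high_piece_eq[OF assms(1)] c(2) c_def[symmetric] using c(1)
    by (simp add: divide_simps) (simp add: field_simps eval_nat_numeral)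
  also have "\<dots> \<le> 1" using poly c(1) by (simp add: c_def)
  finally show ?thesis .
qed

text \<open>
  The downward slope \<open>-B'(x)\<close>, here \<open>57/40 - 17/5 v + (17/360)/C\<^sup>2\<close>, is large enough to pay for the
  growth in \<open>h\<close> of the first factor of \<open>high_piece_curvature\<close> below. The factor \<open>1 + 36 C\<^sup>3\<close> is the quotient of
  \<open>17/10 + (17/360)/C\<^sup>3\<close> and \<open>(17/360)/C\<^sup>3\<close>. Crude bounds are enough: the slope is replaced by its approximate
  tangent at \<open>v = 21/50\<close>, the profile by \<open>63/125\<close>, and \<open>h\<close> by the end \<open>\<eta>\<close> of its range.
\<close>

lemma high_piece_curvature_slope:
  assumes v: "0 \<le> v" "v \<le> 21/50" and h: "0 \<le> h" "h \<le> v" "v + h \<le> 13/20"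
  defines "C \<equiv> v + 1/6"
  shows "h * high_piece v \<le> (57/40 - 17/5*v + 17/360 / C\<^sup>2) * (C\<^sup>2 - h\<^sup>2) * (1 + 36 * C^3)"
    and "0 \<le> 57/40 - 17/5*v + 17/360 / C\<^sup>2"
proof -
  let ?s = "57/40 - 17/5*v + 17/360 / C\<^sup>2" and ?L = "7/4 - 77/20*v"
  have C: "1/6 \<le> C" "0 < C\<^sup>2" using v by (auto simp: C_def)
  have "0 \<le> 11/288 + (-23/240)*v + (-7/40)*v^2 + 9/20*v^3"
    by (rule cubic_nonneg[where a="0" and b="21/50"]) (use v in \<open>simp_all add: power_divide\<close>)
  then have "0 \<le> (9/20*v - 13/40) * C\<^sup>2 + 17/360"
    by (simp add: C_def field_simps power2_eq_square power3_eq_cube)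
  also have "\<dots> = (?s - ?L) * C\<^sup>2" using C by (simp add: field_simps)
  finally have sL: "?L \<le> ?s" using C by (simp add: zero_le_mult_iff)
  then show s0: "0 \<le> ?s" using v by simp
  have L0: "0 \<le> ?L" using v by simp
  have hR: "h * high_piece v \<le> h * (63/125)" using high_piece_le_const[of v] v h by (intro mult_left_mono) auto
  have bound: "h * high_piece v \<le> ?s * (C\<^sup>2 - h\<^sup>2) * (1 + 36 * C^3)"
    if "h \<le> \<eta>" "0 \<le> Y" "Y \<le> C\<^sup>2 - \<eta>\<^sup>2" "0 \<le> k" "k \<le> 1 + 36 * C^3" "63/125 * \<eta> \<le> ?L * Y * k" for \<eta> Y k
  proof -
    have "h\<^sup>2 \<le> \<eta>\<^sup>2" using that(1) h by (intro power_mono)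
    then have "?L * Y * k \<le> ?s * (C\<^sup>2 - h\<^sup>2) * (1 + 36 * C^3)"
      using that sL L0 by (intro mult_mono) auto
    then show ?thesis using hR that(1,6) by simp
  qed
  have cube: "k \<le> 1 + 36 * C^3" if "c \<le> C" "0 \<le> c" "k \<le> 1 + 36 * c^3" for c k
    using power_mono[OF that(1,2), of 3] that(3) by simp
  consider (a) "v \<le> 1/5" | (b) "1/5 \<le> v" "v \<le> 13/40" | (c) "13/40 \<le> v" using v by linarith
  then show "h * high_piece v \<le> ?s * (C\<^sup>2 - h\<^sup>2) * (1 + 36 * C^3)"
  proof cases
    case a
    have "0 \<le> 49/864 + 5593/108000*v + (-539/360)*v^2 + 0*v^3"
      by (rule cubic_nonneg[where a="0" and b="1/5"]) (use v a in \<open>simp_all add: power_divide\<close>)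
    then show ?thesis
      by (intro bound[where \<eta>=v and Y="(12*v + 1)/36" and k="7/6"] cube[where c="1/6"])
         (use h v C in \<open>auto simp: C_def field_simps power2_eq_square power3_eq_cube\<close>)
  next
    case b
    have "0 \<le> 1939/14400 + 58723/72000*v + (-21329/6000)*v^2 + 0*v^3"
      by (rule cubic_nonneg[where a="1/5" and b="13/40"]) (use b in \<open>simp_all add: power_divide\<close>)
    then show ?thesis
      by (intro bound[where \<eta>=v and Y="(12*v + 1)/36" and k="277/100"] cube[where c="11/30"])
         (use h v b C in \<open>auto simp: C_def field_simps power2_eq_square power3_eq_cube\<close>)
  next
    case c
    have "0 \<le> (-5713813/1440000) + 169748159/7200000*v + (-1988371/60000)*v^2 + 0*v^3"
      by (rule cubic_nonneg[where a="13/40" and b="21/50"]) (use v c in \<open>simp_all add: power_divide\<close>)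
    then show ?thesis
      by (intro bound[where \<eta>="13/20 - v" and Y="(2*v - 29/60) * (49/60)" and k="527/100"] cube[where c="59/120"])
         (use h v c C in \<open>auto simp: C_def field_simps power2_eq_square power3_eq_cube\<close>)
  qed
qed

text \<open>
  Near \<open>v = 1/2\<close> the slope changes sign and the compensation breaks down, but there is slack in the local
  condition. On a short interval \<open>[v0, v1]\<close> every quantity is replaced by its extreme value.
\<close>

lemma high_piece_box:
  assumes "v0 \<le> v" "v \<le> v1" "0 \<le> v0" "v1 \<le> 1/2" and h: "0 \<le> h" "v + h \<le> 13/20"
    and b: "0 \<le> \<beta>" "-57/40 + 17/5*v1 - 17/360 / (v1 + 1/6)\<^sup>2 \<le> \<beta>"
    and pos: "(13/20 - v0)\<^sup>2 < (v0 + 1/6)\<^sup>2"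
    and box: "(17/10 + 17/360 / ((v0 + 1/6) * ((v0 + 1/6)\<^sup>2 - (13/20 - v0)\<^sup>2))) * (63/125 + \<beta> * (13/20 - v0)) \<le> 1"
  shows "(17/10 + 17/360 / ((v + 1/6) * ((v + 1/6)\<^sup>2 - h\<^sup>2))) *
    (high_piece v - (57/40 - 17/5*v + 17/360 / (v + 1/6)\<^sup>2) * h) \<le> 1"
proof -
  let ?\<eta> = "13/20 - v0" and ?C = "v0 + 1/6"
  have hh: "h \<le> ?\<eta>" "h\<^sup>2 \<le> ?\<eta>\<^sup>2" using assms by (auto intro!: power_mono)
  have CC: "?C\<^sup>2 \<le> (v + 1/6)\<^sup>2" "(v + 1/6)\<^sup>2 \<le> (v1 + 1/6)\<^sup>2" using assms by (auto intro!: power_mono)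
  have Y: "?C\<^sup>2 - ?\<eta>\<^sup>2 \<le> (v + 1/6)\<^sup>2 - h\<^sup>2" using hh(2) CC(1) by linarith
  have "?C * (?C\<^sup>2 - ?\<eta>\<^sup>2) \<le> (v + 1/6) * ((v + 1/6)\<^sup>2 - h\<^sup>2)"
    by (rule mult_mono[OF _ Y]; use assms(1,3) pos in linarith)
  moreover have P: "0 < ?C * (?C\<^sup>2 - ?\<eta>\<^sup>2)" using assms(3) pos by (intro mult_pos_pos) linarith+
  ultimately have 1: "17/360 / ((v + 1/6) * ((v + 1/6)\<^sup>2 - h\<^sup>2)) \<le> 17/360 / (?C * (?C\<^sup>2 - ?\<eta>\<^sup>2))"
    by (intro frac_le) auto
  have "17/360 / (v1 + 1/6)\<^sup>2 \<le> 17/360 / (v + 1/6)\<^sup>2"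
    using CC assms by (intro divide_left_mono mult_pos_pos) auto
  then have "- (57/40 - 17/5*v + 17/360 / (v + 1/6)\<^sup>2) \<le> \<beta>" using b(2) assms(2) by simp
  then have "- (57/40 - 17/5*v + 17/360 / (v + 1/6)\<^sup>2) * h \<le> \<beta> * ?\<eta>"
    using h(1) hh(1) b(1) by (meson mult_left_mono mult_right_mono order_trans)
  then have 2: "high_piece v - (57/40 - 17/5*v + 17/360 / (v + 1/6)\<^sup>2) * h \<le> 63/125 + \<beta> * ?\<eta>"
    using high_piece_le_const[of v] assms(1-4) unfolding mult_minus_left by linarith
  have X: "0 \<le> 17/360 / ((v + 1/6) * ((v + 1/6)\<^sup>2 - h\<^sup>2))"
    using Y pos assms by (intro divide_nonneg_nonneg mult_nonneg_nonneg) linarith+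
  have "(17/10 + 17/360 / ((v + 1/6) * ((v + 1/6)\<^sup>2 - h\<^sup>2))) *
      (high_piece v - (57/40 - 17/5*v + 17/360 / (v + 1/6)\<^sup>2) * h)
    \<le> (17/10 + 17/360 / ((v + 1/6) * ((v + 1/6)\<^sup>2 - h\<^sup>2))) * (63/125 + \<beta> * ?\<eta>)"
    using 2 X by (intro mult_left_mono) auto
  also have "\<dots> \<le> (17/10 + 17/360 / (?C * (?C\<^sup>2 - ?\<eta>\<^sup>2))) * (63/125 + \<beta> * ?\<eta>)"
    using 1 b(1) hh(1) h(1) by (intro mult_right_mono) auto
  finally show ?thesis using box by linarith
qed

text \<open>
  For the midpoint \<open>1 - v\<close> and the half distance \<open>h\<close>, the first factor is \<open>-1/(2 h\<^sup>2)\<close> times the second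
  difference of the rational piece. The second factor bounds
  \<open>B(c) + (B(y) - B(x))/2\<close> from above. At \<open>h = 0\<close> this is the local condition. The constraints on \<open>h\<close> say that
  \<open>y \<le> 1\<close> and \<open>x \<ge> 7/20\<close>.
\<close>

lemma high_piece_curvature:
  assumes v: "0 \<le> v" "v \<le> 1/2" and h: "0 \<le> h" "h \<le> v" "v + h \<le> 13/20"
  defines "C \<equiv> v + 1/6"
  shows "(17/10 + 17/360 / (C * (C\<^sup>2 - h\<^sup>2))) * (high_piece v - (57/40 - 17/5*v + 17/360 / C\<^sup>2) * h) \<le> 1"
proof (cases "v \<le> 21/50")
  case True
  let ?s = "57/40 - 17/5*v + 17/360 / C\<^sup>2" and ?Y = "C\<^sup>2 - h\<^sup>2" and ?P = "17/10 + 17/360 / C^3"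
  have C: "0 < C" "h < C" using v h by (auto simp: C_def)
  have Y: "0 < ?Y" using C h by (simp add: power_strict_mono)
  have PR: "?P * high_piece v \<le> 1" using high_piece_curvature_at_point[of v] v True by (simp add: C_def)
  have s: "h * high_piece v \<le> ?s * ?Y * (1 + 36 * C^3)" "0 \<le> ?s"
    using high_piece_curvature_slope[OF v(1) True h] unfolding C_def by auto
  have "17/360 / C^3 * (h * high_piece v) \<le> 17/360 / C^3 * (?s * ?Y * (1 + 36 * C^3))"
    using s(1) C by (intro mult_left_mono) auto
  also have "\<dots> = ?s * ?Y * ?P" using C by (simp add: field_simps)
  finally have "17/360 / C^3 * (h * high_piece v) * (h / ?Y) \<le> ?s * ?Y * ?P * (h / ?Y)"
    using Y h by (intro mult_right_mono) auto
  also have "\<dots> = ?P * (?s * h)" using Y by simp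
  also have "\<dots> \<le> (17/10 + 17/360 / (C * ?Y)) * (?s * h)"
  proof -
    have "C * ?Y \<le> C^3" using C by (simp add: power3_eq_cube power2_eq_square algebra_simps)
    then have "17/360 / C^3 \<le> 17/360 / (C * ?Y)" using C Y by (intro divide_left_mono) auto
    then show ?thesis using s(2) h by (intro mult_right_mono) auto
  qed
  finally have *: "17/360 / C^3 * (h * high_piece v) * (h / ?Y) \<le> (17/10 + 17/360 / (C * ?Y)) * (?s * h)" .
  \<comment> \<open>Passing from \<open>0\<close> to \<open>h\<close> multiplies the contribution of the pole to the first factor by \<open>1 + h\<^sup>2/Y\<close>.\<close>
  define X where "X = 17/360 / (C * ?Y)"
  have "X = 17/360 / C^3 + 17/360 / C^3 * h * (h / ?Y)"
    unfolding X_def using C Y by (simp add: divide_simps) (simp add: field_simps power2_eq_square power3_eq_cube)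
  then have "(17/10 + X) * high_piece v = ?P * high_piece v + 17/360 / C^3 * (h * high_piece v) * (h / ?Y)"
    by (simp add: algebra_simps)
  moreover have "(17/10 + X) * (high_piece v - ?s * h) = (17/10 + X) * high_piece v - (17/10 + X) * (?s * h)"
    by (rule right_diff_distrib)
  ultimately have "(17/10 + X) * (high_piece v - ?s * h) \<le> 1" using *[folded X_def] PR by linarith
  then show ?thesis unfolding X_def .
next
  case False
  consider (a) "21/50 \<le> v" "v \<le> 9/20" | (b) "9/20 \<le> v" "v \<le> 19/40"
    | (c) "19/40 \<le> v" "v \<le> 39/80" | (d) "39/80 \<le> v" using False by linarith
  then show ?thesis
  proof cases
    case a
    show ?thesis unfolding C_def by (rule high_piece_box[OF a, where \<beta>=0]) (use h in \<open>simp_all add: power_divide\<close>)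
  next
    case b
    show ?thesis unfolding C_def by (rule high_piece_box[OF b, where \<beta>="379/5000"]) (use h in \<open>simp_all add: power_divide\<close>)
  next
    case c
    show ?thesis unfolding C_def by (rule high_piece_box[OF c, where \<beta>="1224/10000"]) (use h in \<open>simp_all add: power_divide\<close>)
  next
    case d
    show ?thesis unfolding C_def by (rule high_piece_box[OF d v(2), where \<beta>="27/160"]) (use h in \<open>simp_all add: power_divide\<close>)
  qed
qed

text \<open>
  Write \<open>w = 2 B(c) - B(x) - B(y)\<close> for the midpoint \<open>c\<close>. Then \<open>(2 B(c) - B(x))\<^sup>2 - B(y)\<^sup>2\<close> factors as
  \<open>2 w (B(c) + (B(y) - B(x))/2)\<close>, which must not exceed \<open>(y-x)\<^sup>2 = 4 h\<^sup>2\<close>. For the rational piece \<open>w\<close> is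
  \<open>2 h\<^sup>2\<close> times the first factor of \<open>high_piece_curvature\<close>.
\<close>

lemma two_point_near_right:
  assumes "7/20 \<le> x" "x \<le> y" "y \<le> 1" "1 \<le> x + y"
  shows "2 * profile ((x + y) / 2) - profile x \<le> gain (profile y) (y - x)"
proof -
  define v where "v = 1 - (x + y) / 2"
  define h where "h = (y - x) / 2"
  define C where "C = v + 1/6"
  have vh: "0 \<le> v" "v \<le> 1/2" "0 \<le> h" "h \<le> v" "v + h \<le> 13/20"
    using assms by (auto simp: v_def h_def field_simps)
  have args: "1 - x = v + h" "1 - y = v - h" "y - x = 2 * h" "1 - (x + y) / 2 = v"
    by (auto simp: v_def h_def field_simps)
  have C: "0 < C" "h < C" using vh by (auto simp: C_def)
  let ?Y = "C\<^sup>2 - h\<^sup>2"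
  have Y: "0 < ?Y" "?Y \<le> C\<^sup>2" using C vh by (auto simp: power_strict_mono)
  have Yf: "?Y = (C - h) * (C + h)" by (simp add: power2_eq_square algebra_simps)
  have "high_piece (v + h) \<le> profile x"
  proof (cases "x \<le> 1/2")
    case True
    then show ?thesis
      using high_piece_le_mid_piece[of "1/2 - x"] mid_piece_le_profile[of x] assms args(1) by simp
  next
    case False
    then show ?thesis using profile_high[of x] args(1) by simp
  qed
  moreover have "profile ((x + y) / 2) = high_piece v" "profile y = high_piece (v - h)"
    using assms profile_high[of y] profile_high[of "(x + y) / 2"] unfolding args by auto
  moreover have "2 * high_piece v - high_piece (v + h) \<le> gain (high_piece (v - h)) (2 * h)"
  proof (rule gain_ge_circle)
    let ?R = "high_piece v" and ?Rp = "high_piece (v + h)" and ?Rm = "high_piece (v - h)"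
    define w where "w = 2 * ?R - ?Rp - ?Rm"
    define m where "m = ?R + (?Rm - ?Rp) / 2"
    define p q r where "p = 1 / (C + h)" and "q = 1 / (C - h)" and "r = 1 / C"
    have pf: "?R = 57/40 * v - 17/10 * v\<^sup>2 + 17/60 - 17/360 * r"
      "?Rp = 57/40 * (v + h) - 17/10 * (v + h)\<^sup>2 + 17/60 - 17/360 * p"
      "?Rm = 57/40 * (v - h) - 17/10 * (v - h)\<^sup>2 + 17/60 - 17/360 * q"
      using vh by (simp_all add: high_piece_partial_fraction p_def q_def r_def C_def algebra_simps)
    have inv: "p = (C - h) / ?Y" "q = (C + h) / ?Y"
      unfolding Yf p_def q_def using C vh by (simp_all add: divide_simps)
    define t where "t = 1 / (C * ?Y)"
    have "p + q - 2 * r = 2 * h\<^sup>2 * t"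
      unfolding inv r_def t_def using C Y by (simp add: divide_simps) (simp add: field_simps power2_eq_square)
    moreover have "w = 17/5 * h\<^sup>2 + 17/360 * (p + q - 2 * r)"
      unfolding w_def pf by (simp add: field_simps power2_eq_square)
    ultimately have "w = 2 * h\<^sup>2 * (17/10 + 17/360 * t)"
      by (simp add: algebra_simps)
    then have w: "w = 2 * h\<^sup>2 * (17/10 + 17/360 / (C * ?Y))"
      by (simp only: t_def times_divide_eq_right mult_1_right)
    define u where "u = 1 / ?Y"
    have "q - p = 2 * h * u"
      unfolding inv diff_divide_distrib[symmetric] u_def by simp
    moreover have "m = ?R - (57/40 - 17/5*v) * h - 17/720 * (q - p)"
      unfolding m_def pf(2,3) by (simp add: field_simps power2_eq_square)
    ultimately have "m = ?R - (57/40 - 17/5*v + 17/360 * u) * h"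
      by (simp add: algebra_simps)
    then have m: "m = ?R - (57/40 - 17/5*v + 17/360 / ?Y) * h"
      by (simp only: u_def times_divide_eq_right mult_1_right)
    have "17/360 / C\<^sup>2 \<le> 17/360 / ?Y" using C Y by (intro divide_left_mono mult_pos_pos) auto
    then have "(57/40 - 17/5*v + 17/360 / C\<^sup>2) * h \<le> (57/40 - 17/5*v + 17/360 / ?Y) * h"
      using vh by (intro mult_right_mono) auto
    then have m_le: "m \<le> ?R - (57/40 - 17/5*v + 17/360 / C\<^sup>2) * h" unfolding m by simp
    have "(17/10 + 17/360 / (C * ?Y)) * m
        \<le> (17/10 + 17/360 / (C * ?Y)) * (?R - (57/40 - 17/5*v + 17/360 / C\<^sup>2) * h)"
      using m_le C Y by (intro mult_left_mono add_nonneg_nonneg) auto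
    also have "\<dots> \<le> 1" unfolding C_def by (rule high_piece_curvature[OF vh])
    finally have "4 * h\<^sup>2 * ((17/10 + 17/360 / (C * ?Y)) * m) \<le> 4 * h\<^sup>2 * 1"
      by (intro mult_left_mono) auto
    moreover have "(2 * ?R - ?Rp)\<^sup>2 - ?Rm\<^sup>2 = 2 * w * m"
      by (simp add: w_def m_def power2_eq_square field_simps)
    ultimately show "(2 * ?R - ?Rp)\<^sup>2 \<le> ?Rm\<^sup>2 + (2 * h)\<^sup>2"
      unfolding w by (simp add: algebra_simps)
  qed
  ultimately show ?thesis unfolding args by simp
qed

section \<open>The sharp Poincare inequality\<close>

lemma profile_two_point:
  assumes "0 \<le> x" "x \<le> y" "y \<le> 1"
  shows "2 * profile ((x + y) / 2) \<le> profile x + gain (profile y) (y - x)"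
proof -
  consider "y \<le> 1/2" | "1/2 \<le> y" "x + y \<le> 1" | "1 \<le> x + y" "x \<le> 7/20" | "1 \<le> x + y" "7/20 \<le> x"
    by linarith
  then have "2 * profile ((x + y) / 2) - profile x \<le> gain (profile y) (y - x)"
    using assms by cases (auto intro: two_point_left two_point_straddle two_point_far_right two_point_near_right)
  then show ?thesis by simp
qed

theorem theorem1p3:
  fixes n :: nat
  assumes "n \<ge> 1"
  shows "(\<forall>f \<in> cube n \<rightarrow> {0, 1}. grad_norm1 n f \<ge> norm1 n (\<lambda>x. f x - expect n f)) \<and>
         (\<forall>A f. half_cube n A \<and> f = indicator A \<longrightarrow>
            grad_norm1 n f = norm1 n (\<lambda>x. f x - expect n f))"
proof (intro conjI ballI allI impI)
  fix f :: "(nat \<Rightarrow> nat) \<Rightarrow> real" assume "f \<in> cube n \<rightarrow> {0, 1}"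
  then show "norm1 n (\<lambda>x. f x - expect n f) \<le> grad_norm1 n f"
    by (intro poincare_of_profile[of profile] profile_0 profile_1 profile_nonneg profile_two_point profile_sum)
next
  fix A and f :: "(nat \<Rightarrow> nat) \<Rightarrow> real" assume "half_cube n A \<and> f = indicator A"
  then show "grad_norm1 n f = norm1 n (\<lambda>x. f x - expect n f)"
    using half_cube_equality by blast
qed

end
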